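(* Let $X\subset\mathbb{R}^n$ be a finite dataset, $\delta\ge0$, and let $X_\delta\subset\mathbb{R}^n$ be a dataset obtained by perturbing $X$ by at most $\delta$. Fix $MinPts$ and let DBSCAN be used to cluster both $X$ and $X_\delta$ in the bins of $\mathbb{B}_s$ with radius $r$, for all $(s,r)\in\mathbb{R}^2$, giving the cluster covers $\mathbb{C}_{(s,r)}$ of $X$ and $\mathbb{D}_{(s,r)}$ of $X_\delta$. Assume no free-border point exists (for $X$ or for $X_\delta$, in any bin and for any radius considered). Then, for every $k$, the bi-filtration of homology groups $\{H_k(\mathbb{N}(\mathbb{C}_{(s,r)}))\}_{(s,r)\in\mathbb{R}^2}$ of $X$ and the bi-filtration of homology groups $\{H_k(\mathbb{N}(\mathbb{D}_{(s,r)}))\}_{(s,r)\in\mathbb{R}^2}$ of $X_\delta$ are $2\delta$-interleaved.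
   Context: Perturbation. There is a bijection $X\to X_\delta$, $x\mapsto x_\delta$, with $dist(x,x_\delta)\le\delta$ for all $x\in X$ (Euclidean distance). DBSCAN. Let $Y$ be a finite (ordered) set of points, $\epsilon\in\mathbb{R}$ a radius, $MinPts$ a positive integer, and $N_\epsilon(p)=\{q\in Y: dist(p,q)\le\epsilon\}$ for $p\in Y$. A point $p\in Y$ is a core point if $|N_\epsilon(p)|\ge MinPts$; a border point if it is not core but lies in $N_\epsilon(p')$ for some core point $p'$; and noise otherwise. A point $q$ is directly density-reachable from $p$ if $p$ is core and $q\in N_\epsilon(p)$. A point $q$ is density-reachable from $p$ if there are points $p=\alpha_1,\dots,\alpha_m=q$ in $Y$, $m\ge 2$, with each $\alpha_{i+1}$ directly density-reachable from $\alpha_i$. Points $p,q$ are density-connected if there is a point $o\in Y$ from which both are density-reachable. DBSCAN outputs a partition $Y=C_1\sqcup\dots\sqcup C_m\sqcup N$, with $N$ the set of noise points and the clusters $C_i$, each containing at least one core point, satisfying: (Maximality) if $p\in C_i$, $q\notin \bigsqcup_{j<i}C_j$ and $q$ is density-reachable from $p$, then $q\in C_i$; (Connectivity) any $p,q\in C_i$ are density-connected. A point $s\in Y$ is a free-border point with respect to $\epsilon$ and $MinPts$ if $|N_\epsilon(s)|<MinPts$ and there are core points $p,q\in Y$ with $s\in N_\epsilon(p)$, $s\in N_\epsilon(q)$ and $p$ not density-connected to $q$. Bins. For each $s\in\mathbb{R}$, $\mathbb{B}_s=\{b_{\alpha,s}\}_{\alpha\in A}$ is a finite collection of regions of $\mathbb{R}^n$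 (bins), with $A$ independent of $s$, where $\mathbb{B}_{s+t}$ ($t\ge0$) is obtained from $\mathbb{B}_s$ by enlarging each bin by $t$: $b_{\alpha,s}\subseteq b_{\alpha,s+t}$, and every point of $\mathbb{R}^n$ within distance $t$ of $b_{\alpha,s}$ lies in $b_{\alpha,s+t}$. Cluster covers. $\mathbb{C}_{(s,r)}$ (resp. $\mathbb{D}_{(s,r)}$) is the family of clusters obtained by running DBSCAN with radius $r$ and $MinPts$ separately on each $X\cap b_{\alpha,s}$ (resp. $X_\delta\cap b_{\alpha,s}$), indexed by the bin index $\alpha$ they come from (clusters in different bins are different elements). Noise points lie in no cluster. With $(s,r)\le(s',r')$ iff $s\le s'$ and $r\le r'$, and in the absence of free-border points, a cluster in bin $\alpha$ at $(s,r)$ is sent to the unique cluster in bin $\alpha$ at $(s',r')$ containing it; these are the structure maps of the bi-filtration of cluster covers. Nerve and homology. The nerve $\mathbb{N}(\mathbb{U})$ of an indexed family has the index set as vertices, a finite set of vertices being a simplex iff the corresponding sets have nonempty common intersection. The structure maps of cluster covers induce simplicial maps of nerves and linear maps on $H_k$ (simplicial homology over a fixed field), forming the bi-filtration of homology groups (a two-parameter persistence module). Interleaving. For a two-parameter persistence module $M=\{M_u\}_{u\in\mathbb{R}^2}$ and $\xi\ge0$, let $M(\xi)_u=M_{u+(\xi,\xi)}$ and let $\varphi_M^{\xi}:M\to M(\xi)$ be given by the structure maps $M_u\to M_{u+(\xi,\xi)}$. Modules $M,N$ are $\xi$-interleaved if there are morphisms (families of linear maps commuting with the structure maps) $f:M\to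 N(\xi)$ and $g:N\to M(\xi)$ with $f(\xi)\circ g=\varphi_N^{2\xi}$ and $g(\xi)\circ f=\varphi_M^{2\xi}$. *)

theory Defs
  imports "HOL-Analysis.Analysis" "HOL-Combinatorics.Permutations" "HOL-Algebra.Module"
begin

section \<open>DBSCAN\<close>

definition eps_nbhd :: "'p::metric_space set \<Rightarrow> real \<Rightarrow> 'p \<Rightarrow> 'p set" where
  "eps_nbhd Y \<epsilon> p = {q \<in> Y. dist p q \<le> \<epsilon>}"

definition core_point :: "'p::metric_space set \<Rightarrow> real \<Rightarrow> nat \<Rightarrow> 'p \<Rightarrow> bool" where
  "core_point Y \<epsilon> MinPts p \<longleftrightarrow> p \<in> Y \<and> card (eps_nbhd Y \<epsilon> p) \<ge> MinPts"

definition border_point :: "'p::metric_space set \<Rightarrow> real \<Rightarrow> nat \<Rightarrow> 'p \<Rightarrow> bool" where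
  "border_point Y \<epsilon> MinPts p \<longleftrightarrow>
     p \<in> Y \<and> \<not> core_point Y \<epsilon> MinPts p \<and>
     (\<exists>p'. core_point Y \<epsilon> MinPts p' \<and> p \<in> eps_nbhd Y \<epsilon> p')"

definition noise_points :: "'p::metric_space set \<Rightarrow> real \<Rightarrow> nat \<Rightarrow> 'p set" where
  "noise_points Y \<epsilon> MinPts =
     {p \<in> Y. \<not> core_point Y \<epsilon> MinPts p \<and> \<not> border_point Y \<epsilon> MinPts p}"

definition directly_density_reachable ::
    "'p::metric_space set \<Rightarrow> real \<Rightarrow> nat \<Rightarrow> 'p \<Rightarrow> 'p \<Rightarrow> bool" where
  "directly_density_reachable Y \<epsilon> MinPts p q \<longleftrightarrow>
     core_point Y \<epsilon> MinPts p \<and> q \<in> eps_nbhd Y \<epsilon> p"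

text \<open>Chains of direct reachability have at least one step, hence the (non-reflexive)
  transitive closure. All points on such a chain automatically lie in \<open>Y\<close>.\<close>

definition density_reachable ::
    "'p::metric_space set \<Rightarrow> real \<Rightarrow> nat \<Rightarrow> 'p \<Rightarrow> 'p \<Rightarrow> bool" where
  "density_reachable Y \<epsilon> MinPts = (directly_density_reachable Y \<epsilon> MinPts)\<^sup>+\<^sup>+"

definition density_connected ::
    "'p::metric_space set \<Rightarrow> real \<Rightarrow> nat \<Rightarrow> 'p \<Rightarrow> 'p \<Rightarrow> bool" where
  "density_connected Y \<epsilon> MinPts p q \<longleftrightarrow>
     (\<exists>w\<in>Y. density_reachable Y \<epsilon> MinPts w p \<and> density_reachable Y \<epsilon> MinPts w q)"

definition free_border_point :: "'p::metric_space set \<Rightarrow> real \<Rightarrow> nat \<Rightarrow> 'p \<Rightarrow> bool" where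
  "free_border_point Y \<epsilon> MinPts s \<longleftrightarrow>
     s \<in> Y \<and> card (eps_nbhd Y \<epsilon> s) < MinPts \<and>
     (\<exists>p q. core_point Y \<epsilon> MinPts p \<and> core_point Y \<epsilon> MinPts q \<and>
            s \<in> eps_nbhd Y \<epsilon> p \<and> s \<in> eps_nbhd Y \<epsilon> q \<and>
            \<not> density_connected Y \<epsilon> MinPts p q)"

text \<open>\<open>dbscan_output Y \<epsilon> MinPts Cs\<close> says that the list \<open>Cs\<close> of clusters, in order of discovery, is a
  possible result of DBSCAN on \<open>Y\<close>. In general the result depends on the order in which \<open>Y\<close> is
  processed, so this is a relation rather than a function.\<close>

definition dbscan_output :: "'p::metric_space set \<Rightarrow> real \<Rightarrow> nat \<Rightarrow> 'p set list \<Rightarrow> bool" where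
  "dbscan_output Y \<epsilon> MinPts Cs \<longleftrightarrow>
     \<Union> (set Cs) \<union> noise_points Y \<epsilon> MinPts = Y \<and>
     (\<forall>i<length Cs. Cs ! i \<inter> noise_points Y \<epsilon> MinPts = {}) \<and>
     (\<forall>i<length Cs. \<forall>j<length Cs. i \<noteq> j \<longrightarrow> Cs ! i \<inter> Cs ! j = {}) \<and>
     (\<forall>i<length Cs. \<exists>p\<in>Cs ! i. core_point Y \<epsilon> MinPts p) \<and>
     (\<forall>i<length Cs. \<forall>p q. p \<in> Cs ! i \<and> q \<notin> (\<Union>j<i. Cs ! j) \<and> density_reachable Y \<epsilon> MinPts p q
        \<longrightarrow> q \<in> Cs ! i) \<and>
     (\<forall>i<length Cs. \<forall>p\<in>Cs ! i. \<forall>q\<in>Cs ! i. density_connected Y \<epsilon> MinPts p q)"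


section \<open>Bins and cluster covers\<close>

definition enlarging_bins :: "'a set \<Rightarrow> ('a \<Rightarrow> real \<Rightarrow> 'p::metric_space set) \<Rightarrow> bool" where
  "enlarging_bins A b \<longleftrightarrow>
     finite A \<and>
     (\<forall>\<alpha>\<in>A. \<forall>s t. t \<ge> 0 \<longrightarrow>
        b \<alpha> s \<subseteq> b \<alpha> (s + t) \<and> {x. \<exists>y\<in>b \<alpha> s. dist x y \<le> t} \<subseteq> b \<alpha> (s + t))"

definition dbscan_in_bins ::
    "'p::metric_space set \<Rightarrow> 'a set \<Rightarrow> ('a \<Rightarrow> real \<Rightarrow> 'p set) \<Rightarrow> nat \<Rightarrow>
     (real \<times> real \<Rightarrow> 'a \<Rightarrow> 'p set list) \<Rightarrow> bool" where
  "dbscan_in_bins X A b MinPts \<C> \<longleftrightarrow>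
     (\<forall>s r. \<forall>\<alpha>\<in>A. dbscan_output (X \<inter> b \<alpha> s) r MinPts (\<C> (s, r) \<alpha>))"

definition no_free_border_points ::
    "'p::metric_space set \<Rightarrow> 'a set \<Rightarrow> ('a \<Rightarrow> real \<Rightarrow> 'p set) \<Rightarrow> nat \<Rightarrow> bool" where
  "no_free_border_points X A b MinPts \<longleftrightarrow>
     (\<forall>s r. \<forall>\<alpha>\<in>A. \<not> (\<exists>p. free_border_point (X \<inter> b \<alpha> s) r MinPts p))"

text \<open>Elements of a cluster cover are tagged by the bin they come from; the set attached to
  the index \<open>(\<alpha>, C)\<close> is \<open>C\<close>. Within a bin, clusters are nonempty and disjoint, so they are
  faithfully identified by their underlying sets.\<close>

definition cluster_cover ::
    "'a set \<Rightarrow> (real \<times> real \<Rightarrow> 'a \<Rightarrow> 'p set list) \<Rightarrow> real \<times> real \<Rightarrow> ('a \<times> 'p set) set" where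
  "cluster_cover A \<C> u = (SIGMA \<alpha>:A. set (\<C> u \<alpha>))"

definition cluster_map ::
    "(real \<times> real \<Rightarrow> 'a \<Rightarrow> 'p set list) \<Rightarrow> real \<times> real \<Rightarrow> real \<times> real \<Rightarrow>
     'a \<times> 'p set \<Rightarrow> 'a \<times> 'p set" where
  "cluster_map \<C> u v = (\<lambda>(\<alpha>, C). (\<alpha>, THE C'. C' \<in> set (\<C> v \<alpha>) \<and> C \<subseteq> C'))"

definition nerve :: "'i set \<Rightarrow> ('i \<Rightarrow> 'p set) \<Rightarrow> 'i set set" where
  "nerve I U = {\<sigma>. finite \<sigma> \<and> \<sigma> \<noteq> {} \<and> \<sigma> \<subseteq> I \<and> (\<Inter>i\<in>\<sigma>. U i) \<noteq> {}}"


section \<open>Simplicial homology over a field\<close>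

text \<open>A simplicial complex is a set \<open>K\<close> of finite nonempty sets of vertices. Oriented chains are
  represented as alternating functions on the orderings of simplices: the value of a
  \<open>k\<close>-chain \<open>c\<close> at \<open>vs\<close> is the coefficient of the oriented simplex \<open>[vs]\<close>. So
  \<open>[permute_list \<pi> vs] = sign \<pi> \<cdot> [vs]\<close> corresponds to the same law for \<open>c\<close>.\<close>

definition ordered_simplices :: "'v set set \<Rightarrow> nat \<Rightarrow> 'v list set" where
  "ordered_simplices K k = {vs. distinct vs \<and> length vs = Suc k \<and> set vs \<in> K}"

definition simplicial_chains :: "'v set set \<Rightarrow> nat \<Rightarrow> ('v list \<Rightarrow> 'f::field) set" where
  "simplicial_chains K k =
     {c. {vs. c vs \<noteq> 0} \<subseteq> ordered_simplices K k \<and> finite {vs. c vs \<noteq> 0} \<and>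
         (\<forall>vs\<in>ordered_simplices K k. \<forall>\<pi>. \<pi> permutes {..<length vs} \<longrightarrow>
            c (permute_list \<pi> vs) = of_int (sign \<pi>) * c vs)}"

text \<open>This is the linear extension of
  \<open>\<partial>[v\<^sub>0,\<dots>,v\<^sub>k] = (\<Sum>i\<le>k. (-1)^i [v\<^sub>0,\<dots>,v\<^sub>i\<^sub>-\<^sub>1,v\<^sub>i\<^sub>+\<^sub>1,\<dots>,v\<^sub>k])\<close>: the oriented simplices having
  \<open>[ws]\<close> as a face are the \<open>[v,ws]\<close>, in whose boundary \<open>[ws]\<close> has coefficient \<open>1\<close>. The boundary of
  a \<open>0\<close>-chain is zero (homology is not reduced).\<close>

definition simplicial_boundary :: "nat \<Rightarrow> ('v list \<Rightarrow> 'f::field) \<Rightarrow> 'v list \<Rightarrow> 'f" where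
  "simplicial_boundary k c ws = (if k = 0 then 0 else (\<Sum>v | c (v # ws) \<noteq> 0. c (v # ws)))"

definition simplicial_cycles :: "'v set set \<Rightarrow> nat \<Rightarrow> ('v list \<Rightarrow> 'f::field) set" where
  "simplicial_cycles K k = {c \<in> simplicial_chains K k. simplicial_boundary k c = (\<lambda>_. 0)}"

definition simplicial_boundaries :: "'v set set \<Rightarrow> nat \<Rightarrow> ('v list \<Rightarrow> 'f::field) set" where
  "simplicial_boundaries K k = simplicial_boundary (Suc k) ` simplicial_chains K (Suc k)"

definition homology_class ::
    "'v set set \<Rightarrow> nat \<Rightarrow> ('v list \<Rightarrow> 'f::field) \<Rightarrow> ('v list \<Rightarrow> 'f) set" where
  "homology_class K k z = {\<lambda>vs. z vs + b vs | b. b \<in> simplicial_boundaries K k}"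

text \<open>The quotient vector space of cycles by boundaries; the ring multiplication and unit present in
  the record type of modules play no role. Scaling a coset by \<open>a\<close> adds the boundaries again
  so that the result is a full coset also for \<open>a = 0\<close>.\<close>

definition simplicial_homology ::
    "'v set set \<Rightarrow> nat \<Rightarrow> ('f::field, ('v list \<Rightarrow> 'f) set) module" where
  "simplicial_homology K k =
     \<lparr>carrier = homology_class K k ` simplicial_cycles K k,
      monoid.mult = undefined,
      one = undefined,
      zero = simplicial_boundaries K k,
      add = (\<lambda>P Q. {\<lambda>vs. p vs + q vs | p q. p \<in> P \<and> q \<in> Q}),
      smult = (\<lambda>a P. {\<lambda>vs. a * p vs + b vs | p b. p \<in> P \<and> b \<in> simplicial_boundaries K k})\<rparr>"

text \<open>The chain map of a simplicial map \<open>f\<close> sends \<open>[v\<^sub>0,\<dots>,v\<^sub>k]\<close> to \<open>[f v\<^sub>0,\<dots>,f v\<^sub>k]\<close> if these vertices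
  are distinct and to \<open>0\<close> otherwise. For distinct \<open>ws\<close>, the orderings \<open>vs\<close> with \<open>map f vs = ws\<close>
  represent exactly once each of the simplices mapped onto \<open>set ws\<close>.\<close>

definition simplicial_chain_map ::
    "('v \<Rightarrow> 'w) \<Rightarrow> ('v list \<Rightarrow> 'f::field) \<Rightarrow> 'w list \<Rightarrow> 'f" where
  "simplicial_chain_map f c ws =
     (if distinct ws then (\<Sum>vs | c vs \<noteq> 0 \<and> map f vs = ws. c vs) else 0)"

text \<open>The map induced on homology, into the homology of \<open>L\<close>, sends the coset of \<open>z\<close> to the coset
  of the image of \<open>z\<close>; it is written without choosing a representative.\<close>

definition simplicial_homology_map ::
    "'w set set \<Rightarrow> nat \<Rightarrow> ('v \<Rightarrow> 'w) \<Rightarrow> ('v list \<Rightarrow> 'f::field) set \<Rightarrow> ('w list \<Rightarrow> 'f) set" where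
  "simplicial_homology_map L k f P = (\<Union>z\<in>P. homology_class L k (simplicial_chain_map f z))"


section \<open>Two-parameter persistence modules and interleavings\<close>

text \<open>The field given by a type of class \<open>field\<close>, as a ring with explicit carrier.\<close>

definition type_field :: "'f::field ring" where
  "type_field = \<lparr>carrier = UNIV, monoid.mult = (*), one = 1, zero = 0, add = (+)\<rparr>"

definition linear_maps ::
    "('f, 'v) module \<Rightarrow> ('f, 'w) module \<Rightarrow> ('v \<Rightarrow> 'w) set" where
  "linear_maps V W =
     {h \<in> carrier V \<rightarrow> carrier W.
        (\<forall>x\<in>carrier V. \<forall>y\<in>carrier V. h (x \<oplus>\<^bsub>V\<^esub> y) = h x \<oplus>\<^bsub>W\<^esub> h y) \<and>
        (\<forall>a. \<forall>x\<in>carrier V. h (a \<odot>\<^bsub>V\<^esub> x) = a \<odot>\<^bsub>W\<^esub> h x)}"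

record ('f, 'v) bifiltration =
  bispace :: "real \<times> real \<Rightarrow> ('f, 'v) module"
  bimap :: "real \<times> real \<Rightarrow> real \<times> real \<Rightarrow> 'v \<Rightarrow> 'v"

text \<open>Here and below, \<open>\<le>\<close> on pairs of reals is the componentwise order, and \<open>bimap M u v\<close> is only
  meaningful for \<open>u \<le> v\<close>.\<close>

locale persistence_module =
  fixes M :: "('f::field, 'v) bifiltration"
  assumes vector_space: "Module.module type_field (bispace M u)"
    and linear: "u \<le> v \<Longrightarrow> bimap M u v \<in> linear_maps (bispace M u) (bispace M v)"
    and bimap_refl: "x \<in> carrier (bispace M u) \<Longrightarrow> bimap M u u x = x"
    and bimap_trans: "u \<le> v \<Longrightarrow> v \<le> w \<Longrightarrow> x \<in> carrier (bispace M u) \<Longrightarrow>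
          bimap M v w (bimap M u v x) = bimap M u w x"

definition shifted :: "real \<Rightarrow> ('f, 'v) bifiltration \<Rightarrow> ('f, 'v) bifiltration" where
  "shifted \<xi> M =
     \<lparr>bispace = (\<lambda>u. bispace M (u + (\<xi>, \<xi>))),
      bimap = (\<lambda>u v. bimap M (u + (\<xi>, \<xi>)) (v + (\<xi>, \<xi>)))\<rparr>"

definition persistence_morphism ::
    "('f, 'v) bifiltration \<Rightarrow> ('f, 'w) bifiltration \<Rightarrow> (real \<times> real \<Rightarrow> 'v \<Rightarrow> 'w) \<Rightarrow> bool" where
  "persistence_morphism M N f \<longleftrightarrow>
     (\<forall>u. f u \<in> linear_maps (bispace M u) (bispace N u)) \<and>
     (\<forall>u v. u \<le> v \<longrightarrow>
        (\<forall>x\<in>carrier (bispace M u). f v (bimap M u v x) = bimap N u v (f u x)))"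

definition interleaved ::
    "real \<Rightarrow> ('f::field, 'v) bifiltration \<Rightarrow> ('f, 'w) bifiltration \<Rightarrow> bool" where
  "interleaved \<xi> M N \<longleftrightarrow>
     persistence_module M \<and> persistence_module N \<and> \<xi> \<ge> 0 \<and>
     (\<exists>f g.
        persistence_morphism M (shifted \<xi> N) f \<and>
        persistence_morphism N (shifted \<xi> M) g \<and>
        (\<forall>u. \<forall>x\<in>carrier (bispace N u).
           f (u + (\<xi>, \<xi>)) (g u x) = bimap N u (u + (2 * \<xi>, 2 * \<xi>)) x) \<and>
        (\<forall>u. \<forall>x\<in>carrier (bispace M u).
           g (u + (\<xi>, \<xi>)) (f u x) = bimap M u (u + (2 * \<xi>, 2 * \<xi>)) x))"

definition homology_bifiltration ::
    "'a set \<Rightarrow> (real \<times> real \<Rightarrow> 'a \<Rightarrow> 'p set list) \<Rightarrow> nat \<Rightarrow>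
     ('f::field, (('a \<times> 'p set) list \<Rightarrow> 'f) set) bifiltration" where
  "homology_bifiltration A \<C> k =
     \<lparr>bispace = (\<lambda>u. simplicial_homology (nerve (cluster_cover A \<C> u) snd) k),
      bimap = (\<lambda>u v. simplicial_homology_map (nerve (cluster_cover A \<C> v) snd) k
                       (cluster_map \<C> u v))\<rparr>"

end

theory Submission
  imports Defs
begin

text \<open>The interleaving comes from maps of points. Moving every point by at most \<open>\<delta>\<close> changes pairwise
  distances by at most \<open>2 * \<delta>\<close>, so after enlarging bins and radius by \<open>2 * \<delta>\<close> the injective map
  \<open>x \<mapsto> x\<^sub>\<delta>\<close> sends neighbours to neighbours. It therefore preserves core points and density-reachability,
  and so does its inverse in the other direction; for the identity of \<open>X\<close> this needs no enlargement.

  Such a map of points induces a map of clusters only if the image of a cluster lies in exactly one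
  cluster. Here the absence of free-border points enters: it makes every cluster closed under
  density-reachability (\<open>dbscan_output_reachable_closed\<close>), so the set of clusters no longer depends on
  the processing order, and a cluster is absorbed as a whole by the cluster that contains the image of
  one of its core points (\<open>dbscan_output_image_unique\<close>).

  The cluster containing an image is unique, so the induced vertex maps compose strictly
  (\<open>cover_map_comp\<close>): applying the perturbation and then its inverse gives the structure map on vertices,
  not merely up to contiguity. Hence no homotopy of chain maps is needed, and the interleaving follows
  from functoriality of simplicial homology. Its one combinatorial ingredient is that chain maps commute
  with boundaries (\<open>simplicial_chain_map_boundary\<close>), where the simplices collapsed by a vertex map
  have to cancel.\<close>

section \<open>Clusters in the absence of free-border points\<close>

lemma core_point_nonneg_radius:
  assumes "core_point Y r m p" "m > 0"
  shows "r \<ge> 0"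
proof -
  have "eps_nbhd Y r p \<noteq> {}"
    using assms by (auto simp: core_point_def)
  then obtain q where "dist p q \<le> r"
    by (auto simp: eps_nbhd_def)
  then show ?thesis
    using zero_le_dist[of p q] by linarith
qed

lemma density_reachable_self:
  assumes "core_point Y r m p" "m > 0"
  shows "density_reachable Y r m p p"
proof -
  have "p \<in> Y"
    using assms(1) by (simp add: core_point_def)
  then have "directly_density_reachable Y r m p p"
    using assms(1) core_point_nonneg_radius[OF assms]
    by (simp add: directly_density_reachable_def eps_nbhd_def)
  then show ?thesis
    unfolding density_reachable_def by (rule tranclp.r_into_trancl)
qed

lemma density_reachable_trans:
  "density_reachable Y r m p q \<Longrightarrow> density_reachable Y r m q t \<Longrightarrow> density_reachable Y r m p t"
  by (simp add: density_reachable_def)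

lemma density_reachable_source_core: "density_reachable Y r m p q \<Longrightarrow> core_point Y r m p"
  unfolding density_reachable_def
  by (induction rule: tranclp_induct) (auto simp: directly_density_reachable_def)

lemma density_reachable_in: "density_reachable Y r m p q \<Longrightarrow> q \<in> Y"
  unfolding density_reachable_def
  by (induction rule: tranclp_induct) (auto simp: directly_density_reachable_def eps_nbhd_def)

text \<open>A chain of direct reachability runs through core points except perhaps at its end, so it can be
  reversed as soon as its end is a core point.\<close>

lemma density_reachable_sym:
  assumes "density_reachable Y r m p q" "core_point Y r m q"
  shows "density_reachable Y r m q p"
  using assms unfolding density_reachable_def
proof (induction rule: tranclp_induct)
  case (base q)
  then show ?case
    by (intro tranclp.r_into_trancl)
      (auto simp: directly_density_reachable_def eps_nbhd_def core_point_def dist_commute)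
next
  case (step q' q)
  have q': "core_point Y r m q'"
    using step.hyps(2) by (simp add: directly_density_reachable_def)
  have "directly_density_reachable Y r m q q'"
    using step.hyps(2) step.prems
    by (auto simp: directly_density_reachable_def eps_nbhd_def core_point_def dist_commute)
  moreover have "(directly_density_reachable Y r m)\<^sup>+\<^sup>+ q' p"
    using step.IH[OF q'] .
  ultimately show ?case
    by (rule tranclp_into_tranclp2)
qed

lemma density_connected_core:
  assumes "density_connected Y r m p q" "core_point Y r m p"
  shows "density_reachable Y r m p q"
proof -
  obtain w where w: "density_reachable Y r m w p" "density_reachable Y r m w q"
    using assms(1) by (auto simp: density_connected_def)
  then show ?thesis
    using density_reachable_trans[OF density_reachable_sym[OF w(1) assms(2)]] by blast
qed

lemma density_reachable_last_core:
  assumes "density_reachable Y r m p q" "m > 0"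
  obtains a where "density_reachable Y r m p a" "core_point Y r m a" "q \<in> eps_nbhd Y r a"
proof -
  have self: "density_reachable Y r m p p"
    using density_reachable_source_core[OF assms(1)] \<open>m > 0\<close> by (rule density_reachable_self)
  obtain a where "density_reachable Y r m p a" "directly_density_reachable Y r m a q"
    using assms(1)[unfolded density_reachable_def]
  proof cases
    case r_into_trancl
    then show ?thesis
      using that self by simp
  next
    case (trancl_into_trancl a)
    then show ?thesis
      using that[of a] by (simp add: density_reachable_def)
  qed
  then show ?thesis
    using that by (simp add: directly_density_reachable_def)
qed

text \<open>Two core points that reach a common point reach each other: if the common point is core, one of
  the two chains can be reversed there; if it is not, then the last core points on the two chains are
  density-connected because the common point is not free-border.\<close>

lemma density_reachable_common:
  assumes "m > 0" "\<not> free_border_point Y r m q"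
    and p: "density_reachable Y r m p q" and p': "density_reachable Y r m p' q"
  shows "density_reachable Y r m p' p"
proof (cases "core_point Y r m q")
  case True
  then show ?thesis
    using density_reachable_trans[OF p' density_reachable_sym[OF p]] by blast
next
  case False
  obtain a where a: "density_reachable Y r m p a" "core_point Y r m a" "q \<in> eps_nbhd Y r a"
    using density_reachable_last_core[OF p \<open>m > 0\<close>] .
  obtain a' where a': "density_reachable Y r m p' a'" "core_point Y r m a'" "q \<in> eps_nbhd Y r a'"
    using density_reachable_last_core[OF p' \<open>m > 0\<close>] .
  have "q \<in> Y" "card (eps_nbhd Y r q) < m"
    using False density_reachable_in[OF p] by (auto simp: core_point_def)
  then have "density_connected Y r m a' a"
    using assms(2) a(2,3) a'(2,3) unfolding free_border_point_def by blast
  then have "density_reachable Y r m a' a"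
    using density_connected_core a'(2) by blast
  moreover have "density_reachable Y r m a p"
    using density_reachable_sym[OF a(1,2)] .
  ultimately show ?thesis
    using density_reachable_trans[OF density_reachable_trans[OF a'(1)]] by blast
qed

lemma dbscan_output_cluster_subset: "dbscan_output Y r m Cs \<Longrightarrow> C \<in> set Cs \<Longrightarrow> C \<subseteq> Y"
  unfolding dbscan_output_def by (elim conjE) blast

lemma dbscan_output_cluster_core:
  assumes "dbscan_output Y r m Cs" "C \<in> set Cs"
  obtains p where "p \<in> C" "core_point Y r m p"
proof -
  have "\<forall>i<length Cs. \<exists>p\<in>Cs ! i. core_point Y r m p"
    using assms(1) unfolding dbscan_output_def by (elim conjE)
  then show ?thesis
    using assms(2) that by (auto simp: in_set_conv_nth)
qed

lemma dbscan_output_disjoint: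
  assumes "dbscan_output Y r m Cs" "C \<in> set Cs" "C' \<in> set Cs" "x \<in> C" "x \<in> C'"
  shows "C = C'"
proof -
  have "\<forall>i<length Cs. \<forall>j<length Cs. i \<noteq> j \<longrightarrow> Cs ! i \<inter> Cs ! j = {}"
    using assms(1) unfolding dbscan_output_def by (elim conjE)
  then show ?thesis
    using assms(2-) by (auto simp: in_set_conv_nth)
qed

lemma dbscan_output_core_in_cluster:
  assumes "dbscan_output Y r m Cs" "core_point Y r m p"
  obtains C where "C \<in> set Cs" "p \<in> C"
proof -
  have "p \<in> Y" "p \<notin> noise_points Y r m"
    using assms(2) by (auto simp: core_point_def noise_points_def)
  moreover have "\<Union> (set Cs) \<union> noise_points Y r m = Y"
    using assms(1) unfolding dbscan_output_def by (elim conjE)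
  ultimately show ?thesis
    using that by blast
qed

lemma dbscan_output_connected:
  assumes "dbscan_output Y r m Cs" "C \<in> set Cs" "p \<in> C" "q \<in> C"
  shows "density_connected Y r m p q"
proof -
  have "\<forall>i<length Cs. \<forall>p\<in>Cs ! i. \<forall>q\<in>Cs ! i. density_connected Y r m p q"
    using assms(1) unfolding dbscan_output_def by (elim conjE)
  then show ?thesis
    using assms(2-) by (auto simp: in_set_conv_nth)
qed

text \<open>The maximality condition of DBSCAN exempts points already taken by an earlier cluster, which is
  where the result depends on the processing order. Without free-border points the exemption is void:
  a point \<open>q\<close> reachable from \<open>p\<close> and taken earlier would be reachable from a core point \<open>p'\<close> of the
  earlier cluster, hence \<open>p'\<close> would reach \<open>p\<close> and the earlier cluster would contain \<open>p\<close> as well.\<close>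

lemma dbscan_output_reachable_closed:
  assumes out: "dbscan_output Y r m Cs" and "m > 0"
    and nofree: "\<And>s. \<not> free_border_point Y r m s"
    and C: "C \<in> set Cs" "p \<in> C" and pq: "density_reachable Y r m p q"
  shows "q \<in> C"
proof (rule ccontr)
  assume "q \<notin> C"
  obtain i where i: "i < length Cs" "C = Cs ! i"
    using C(1) by (auto simp: in_set_conv_nth)
  have "\<forall>i<length Cs. \<forall>p q. p \<in> Cs ! i \<and> q \<notin> (\<Union>j<i. Cs ! j) \<and> density_reachable Y r m p q
      \<longrightarrow> q \<in> Cs ! i"
    using out unfolding dbscan_output_def by (elim conjE)
  then have maximal: "t \<in> Cs ! l"
    if "l < length Cs" "x \<in> Cs ! l" "t \<notin> (\<Union>j<l. Cs ! j)" "density_reachable Y r m x t" for l x t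
    using that by meson
  obtain j where j: "j < i" "q \<in> Cs ! j"
    using maximal[of i p q] i C(2) pq \<open>q \<notin> C\<close> by blast
  then have Cj: "Cs ! j \<in> set Cs"
    using i by simp
  then obtain p' where p': "p' \<in> Cs ! j" "core_point Y r m p'"
    by (rule dbscan_output_cluster_core[OF out])
  have "density_reachable Y r m p' q"
    using dbscan_output_connected[OF out Cj p'(1) j(2)] p'(2) by (rule density_connected_core)
  then have p'p: "density_reachable Y r m p' p"
    using density_reachable_common[OF \<open>m > 0\<close> nofree pq] by blast
  have not_earlier: "p \<notin> (\<Union>l<j. Cs ! l)"
  proof
    assume "p \<in> (\<Union>l<j. Cs ! l)"
    then obtain l where l: "l < j" "p \<in> Cs ! l"
      by blast
    have "\<forall>i<length Cs. \<forall>j<length Cs. i \<noteq> j \<longrightarrow> Cs ! i \<inter> Cs ! j = {}"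
      using out unfolding dbscan_output_def by (elim conjE)
    then have "Cs ! l \<inter> Cs ! i = {}"
      using l(1) i(1) j(1) by auto
    then show False
      using l(2) C(2) i(2) by blast
  qed
  then have "p \<in> Cs ! j"
    using maximal[of j p' p] p'(1) p'p i(1) j(1) by auto
  then have "C = Cs ! j"
    using dbscan_output_disjoint[OF out C(1) Cj] C(2) by blast
  then show False
    using j(2) \<open>q \<notin> C\<close> by simp
qed


section \<open>Maps of cluster covers\<close>

lemma core_point_image:
  assumes "finite Y'" "\<phi> ` Y \<subseteq> Y'" "inj_on \<phi> Y"
    and short: "\<forall>x\<in>Y. \<forall>y\<in>Y. dist x y \<le> r \<longrightarrow> dist (\<phi> x) (\<phi> y) \<le> r'"
    and core: "core_point Y r m p"
  shows "core_point Y' r' m (\<phi> p)"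
proof -
  have p: "p \<in> Y" "m \<le> card (eps_nbhd Y r p)"
    using core by (auto simp: core_point_def)
  have "card (eps_nbhd Y r p) = card (\<phi> ` eps_nbhd Y r p)"
    using assms(3) by (intro card_image[symmetric]) (auto simp: eps_nbhd_def inj_on_def)
  also have "\<dots> \<le> card (eps_nbhd Y' r' (\<phi> p))"
    using assms(1,2) p(1) short by (intro card_mono) (auto simp: eps_nbhd_def image_subset_iff)
  finally show ?thesis
    using p assms(2) by (auto simp: core_point_def)
qed

lemma density_reachable_image:
  assumes "finite Y'" "\<phi> ` Y \<subseteq> Y'" "inj_on \<phi> Y"
    and short: "\<forall>x\<in>Y. \<forall>y\<in>Y. dist x y \<le> r \<longrightarrow> dist (\<phi> x) (\<phi> y) \<le> r'"
    and "density_reachable Y r m p q"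
  shows "density_reachable Y' r' m (\<phi> p) (\<phi> q)"
proof -
  have direct: "directly_density_reachable Y' r' m (\<phi> x) (\<phi> y)"
    if "directly_density_reachable Y r m x y" for x y
  proof -
    have xy: "core_point Y r m x" "x \<in> Y" "y \<in> Y" "dist x y \<le> r"
      using that by (auto simp: directly_density_reachable_def eps_nbhd_def core_point_def)
    have "core_point Y' r' m (\<phi> x)"
      by (rule core_point_image[OF assms(1-4) xy(1)])
    moreover have "\<phi> y \<in> Y'"
      using assms(2) xy(3) by blast
    ultimately show ?thesis
      using short xy by (simp add: directly_density_reachable_def eps_nbhd_def)
  qed
  show ?thesis
    using assms(5) unfolding density_reachable_def
  proof (induction rule: tranclp_induct)
    case (base y)
    then show ?case
      using direct by (simp add: tranclp.r_into_trancl)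
  next
    case (step y z)
    then show ?case
      using direct by (meson tranclp.trancl_into_trancl)
  qed
qed

text \<open>Injectivity keeps the neighbourhood counts from dropping, so core points stay core and a cluster
  stays connected. The cluster around the image of one of its core points is closed under reachability
  and therefore takes in the rest.\<close>

lemma dbscan_output_image_unique:
  assumes "finite Y'" "\<phi> ` Y \<subseteq> Y'" "inj_on \<phi> Y"
    and short: "\<forall>x\<in>Y. \<forall>y\<in>Y. dist x y \<le> r \<longrightarrow> dist (\<phi> x) (\<phi> y) \<le> r'"
    and "m > 0"
    and out: "dbscan_output Y r m Cs" and out': "dbscan_output Y' r' m Cs'"
    and nofree: "\<And>s. \<not> free_border_point Y' r' m s"
    and C: "C \<in> set Cs"
  shows "\<exists>!C'. C' \<in> set Cs' \<and> \<phi> ` C \<subseteq> C'"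
proof -
  obtain p where p: "p \<in> C" "core_point Y r m p"
    using dbscan_output_cluster_core[OF out C] .
  have "core_point Y' r' m (\<phi> p)"
    using core_point_image[OF assms(1-4) p(2)] .
  then obtain C' where C': "C' \<in> set Cs'" "\<phi> p \<in> C'"
    by (rule dbscan_output_core_in_cluster[OF out'])
  have "\<phi> q \<in> C'" if "q \<in> C" for q
  proof -
    have "density_reachable Y r m p q"
      using dbscan_output_connected[OF out C p(1) that] p(2) by (rule density_connected_core)
    then have "density_reachable Y' r' m (\<phi> p) (\<phi> q)"
      by (rule density_reachable_image[OF assms(1-4)])
    then show ?thesis
      using dbscan_output_reachable_closed[OF out' \<open>m > 0\<close> nofree C'] by simp
  qed
  then have image: "\<phi> ` C \<subseteq> C'"
    by blast
  show ?thesis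
  proof (rule ex1I[of _ C'])
    show "C' \<in> set Cs' \<and> \<phi> ` C \<subseteq> C'"
      using C'(1) image by simp
  next
    fix C'' assume C'': "C'' \<in> set Cs' \<and> \<phi> ` C \<subseteq> C''"
    then have "\<phi> p \<in> C''"
      using p(1) by blast
    then show "C'' = C'"
      using dbscan_output_disjoint[OF out' _ C'(1) _ C'(2)] C'' by blast
  qed
qed

definition cover_map ::
    "('p \<Rightarrow> 'q) \<Rightarrow> (real \<times> real \<Rightarrow> 'a \<Rightarrow> 'q set list) \<Rightarrow> real \<times> real \<Rightarrow> 'a \<times> 'p set \<Rightarrow> 'a \<times> 'q set" where
  "cover_map \<phi> \<D> v = (\<lambda>(\<alpha>, C). (\<alpha>, THE C'. C' \<in> set (\<D> v \<alpha>) \<and> \<phi> ` C \<subseteq> C'))"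

lemma cluster_map_eq_cover_map: "cluster_map \<C> u v = cover_map (\<lambda>x. x) \<C> v"
  by (simp add: cluster_map_def cover_map_def)

text \<open>This is the condition under which the definite description in \<open>cover_map\<close> is meaningful.\<close>

definition maps_clusters ::
    "'a set \<Rightarrow> ('p \<Rightarrow> 'q) \<Rightarrow> (real \<times> real \<Rightarrow> 'a \<Rightarrow> 'p set list) \<Rightarrow> real \<times> real \<Rightarrow>
     (real \<times> real \<Rightarrow> 'a \<Rightarrow> 'q set list) \<Rightarrow> real \<times> real \<Rightarrow> bool" where
  "maps_clusters A \<phi> \<C> u \<D> v \<longleftrightarrow>
     (\<forall>\<alpha>\<in>A. \<forall>C\<in>set (\<C> u \<alpha>). \<exists>!C'. C' \<in> set (\<D> v \<alpha>) \<and> \<phi> ` C \<subseteq> C')"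

lemma cover_map_eqI:
  assumes "maps_clusters A \<phi> \<C> u \<D> v" "\<alpha> \<in> A" "C \<in> set (\<C> u \<alpha>)" "C' \<in> set (\<D> v \<alpha>)" "\<phi> ` C \<subseteq> C'"
  shows "cover_map \<phi> \<D> v (\<alpha>, C) = (\<alpha>, C')"
proof -
  have "\<exists>!C'. C' \<in> set (\<D> v \<alpha>) \<and> \<phi> ` C \<subseteq> C'"
    using assms(1-3) by (simp add: maps_clusters_def)
  then have "(THE C'. C' \<in> set (\<D> v \<alpha>) \<and> \<phi> ` C \<subseteq> C') = C'"
    using assms(4,5) by (intro the1_equality) simp_all
  then show ?thesis
    by (simp add: cover_map_def)
qed

lemma cover_map_image:
  assumes "maps_clusters A \<phi> \<C> u \<D> v" "\<alpha> \<in> A" "C \<in> set (\<C> u \<alpha>)"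
  obtains C' where "cover_map \<phi> \<D> v (\<alpha>, C) = (\<alpha>, C')" "C' \<in> set (\<D> v \<alpha>)" "\<phi> ` C \<subseteq> C'"
proof -
  obtain C' where "C' \<in> set (\<D> v \<alpha>)" "\<phi> ` C \<subseteq> C'"
    using assms unfolding maps_clusters_def by blast
  then show ?thesis
    using that[OF cover_map_eqI[OF assms]] by simp
qed

text \<open>The image under \<open>\<phi>\<close> of a point common to some clusters is common to their image clusters.\<close>

lemma cover_map_nerve:
  assumes "maps_clusters A \<phi> \<C> u \<D> v" "\<sigma> \<in> nerve (cluster_cover A \<C> u) snd"
  shows "cover_map \<phi> \<D> v ` \<sigma> \<in> nerve (cluster_cover A \<D> v) snd"
proof -
  have \<sigma>: "finite \<sigma>" "\<sigma> \<noteq> {}" "\<sigma> \<subseteq> cluster_cover A \<C> u" "(\<Inter>i\<in>\<sigma>. snd i) \<noteq> {}"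
    using assms(2) by (auto simp: nerve_def)
  have step: "cover_map \<phi> \<D> v i \<in> cluster_cover A \<D> v \<and> \<phi> ` snd i \<subseteq> snd (cover_map \<phi> \<D> v i)"
    if "i \<in> \<sigma>" for i
  proof -
    have "i \<in> cluster_cover A \<C> u"
      using that \<sigma>(3) by blast
    then obtain \<alpha> C where i: "i = (\<alpha>, C)" "\<alpha> \<in> A" "C \<in> set (\<C> u \<alpha>)"
      by (auto simp: cluster_cover_def)
    obtain C' where "cover_map \<phi> \<D> v (\<alpha>, C) = (\<alpha>, C')" "C' \<in> set (\<D> v \<alpha>)" "\<phi> ` C \<subseteq> C'"
      by (rule cover_map_image[OF assms(1) i(2,3)])
    then show ?thesis
      using i by (simp add: cluster_cover_def)
  qed
  obtain x where "\<And>i. i \<in> \<sigma> \<Longrightarrow> x \<in> snd i"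
    using \<sigma>(4) by blast
  then have "\<phi> x \<in> snd (cover_map \<phi> \<D> v i)" if "i \<in> \<sigma>" for i
    using step[OF that] that by blast
  then have "\<phi> x \<in> (\<Inter>i\<in>\<sigma>. snd (cover_map \<phi> \<D> v i))"
    by (rule INT_I)
  then have "(\<Inter>i\<in>cover_map \<phi> \<D> v ` \<sigma>. snd i) \<noteq> {}"
    unfolding image_image by blast
  moreover have "cover_map \<phi> \<D> v ` \<sigma> \<subseteq> cluster_cover A \<D> v"
    by (rule image_subsetI) (rule step[THEN conjunct1])
  ultimately show ?thesis
    using \<sigma>(1,2) unfolding nerve_def by blast
qed

lemma cover_map_comp:
  assumes "maps_clusters A \<phi> \<C> u \<D> v" "maps_clusters A \<psi> \<D> v \<E> w" "maps_clusters A \<theta> \<C> u \<E> w"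
    and comp: "\<forall>\<alpha>\<in>A. \<forall>C\<in>set (\<C> u \<alpha>). \<forall>x\<in>C. \<psi> (\<phi> x) = \<theta> x"
    and i: "i \<in> cluster_cover A \<C> u"
  shows "cover_map \<psi> \<E> w (cover_map \<phi> \<D> v i) = cover_map \<theta> \<E> w i"
proof -
  obtain \<alpha> C where i: "i = (\<alpha>, C)" "\<alpha> \<in> A" "C \<in> set (\<C> u \<alpha>)"
    using i by (auto simp: cluster_cover_def)
  obtain C' where C': "cover_map \<phi> \<D> v i = (\<alpha>, C')" "C' \<in> set (\<D> v \<alpha>)" "\<phi> ` C \<subseteq> C'"
    using i(1) by (auto elim: cover_map_image[OF assms(1) i(2,3)])
  obtain C'' where C'': "cover_map \<psi> \<E> w (\<alpha>, C') = (\<alpha>, C'')" "C'' \<in> set (\<E> w \<alpha>)" "\<psi> ` C' \<subseteq> C''"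
    by (rule cover_map_image[OF assms(2) i(2) C'(2)])
  have "\<theta> ` C \<subseteq> C''"
  proof
    fix y assume "y \<in> \<theta> ` C"
    then obtain x where x: "x \<in> C" "y = \<theta> x"
      by blast
    then have "y = \<psi> (\<phi> x)"
      using comp i(2,3) x by simp
    moreover have "\<phi> x \<in> C'"
      using C'(3) x(1) by blast
    ultimately show "y \<in> C''"
      using C''(3) by blast
  qed
  then have "cover_map \<theta> \<E> w i = (\<alpha>, C'')"
    using cover_map_eqI[OF assms(3) i(2,3) C''(2)] i(1) by simp
  then show ?thesis
    using C'(1) C''(1) by simp
qed

lemma cover_map_refl:
  assumes "maps_clusters A (\<lambda>x. x) \<C> u \<C> u" "i \<in> cluster_cover A \<C> u"
  shows "cover_map (\<lambda>x. x) \<C> u i = i"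
proof -
  obtain \<alpha> C where i: "i = (\<alpha>, C)" "\<alpha> \<in> A" "C \<in> set (\<C> u \<alpha>)"
    using assms(2) by (auto simp: cluster_cover_def)
  then show ?thesis
    using cover_map_eqI[OF assms(1) i(2,3) i(3)] by simp
qed

text \<open>Moving each point by at most \<open>e\<close> needs the bins to grow by \<open>e\<close> and the radius to grow by \<open>2 e\<close>.
  The structure maps of a cluster cover are the case \<open>e = 0\<close>.\<close>

lemma maps_clusters_perturbation:
  fixes X X' :: "'p::metric_space set" and \<phi> :: "'p \<Rightarrow> 'p"
  assumes "finite X'" "\<phi> ` X \<subseteq> X'" "inj_on \<phi> X"
    and move: "\<And>x. x \<in> X \<Longrightarrow> dist x (\<phi> x) \<le> e" and "e \<ge> 0"
    and "s + e \<le> s'" "r + 2 * e \<le> r'"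
    and "m > 0" and bins: "enlarging_bins A b"
    and \<C>: "dbscan_in_bins X A b m \<C>" and \<D>: "dbscan_in_bins X' A b m \<D>"
    and nofree: "no_free_border_points X' A b m"
  shows "maps_clusters A \<phi> \<C> (s, r) \<D> (s', r')"
  unfolding maps_clusters_def
proof (intro ballI)
  fix \<alpha> C
  assume \<alpha>: "\<alpha> \<in> A" and C: "C \<in> set (\<C> (s, r) \<alpha>)"
  have "\<phi> x \<in> b \<alpha> s'" if "x \<in> X" "x \<in> b \<alpha> s" for x
  proof -
    have "s' - s \<ge> 0"
      using assms(5,6) by simp
    then have "{x. \<exists>y\<in>b \<alpha> s. dist x y \<le> s' - s} \<subseteq> b \<alpha> (s + (s' - s))"
      using bins \<alpha> unfolding enlarging_bins_def by blast
    moreover have "dist (\<phi> x) x \<le> s' - s"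
      using move[OF that(1)] assms(6) by (simp add: dist_commute)
    ultimately show ?thesis
      using that(2) by auto
  qed
  then have image: "\<phi> ` (X \<inter> b \<alpha> s) \<subseteq> X' \<inter> b \<alpha> s'"
    using assms(2) by blast
  have short: "\<forall>x\<in>X \<inter> b \<alpha> s. \<forall>y\<in>X \<inter> b \<alpha> s. dist x y \<le> r \<longrightarrow> dist (\<phi> x) (\<phi> y) \<le> r'"
  proof (intro ballI impI)
    fix x y
    assume that: "x \<in> X \<inter> b \<alpha> s" "y \<in> X \<inter> b \<alpha> s" "dist x y \<le> r"
    have "dist (\<phi> x) (\<phi> y) \<le> dist x (\<phi> x) + dist x y + dist y (\<phi> y)"
      using dist_triangle[of "\<phi> x" "\<phi> y" x] dist_triangle[of x "\<phi> y" y]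
      by (simp add: dist_commute[of "\<phi> x" x])
    moreover have "dist x (\<phi> x) \<le> e" "dist y (\<phi> y) \<le> e"
      using move that by blast+
    ultimately show "dist (\<phi> x) (\<phi> y) \<le> r'"
      using that(3) assms(7) by linarith
  qed
  have fin: "finite (X' \<inter> b \<alpha> s')" and inj: "inj_on \<phi> (X \<inter> b \<alpha> s)"
    using assms(1,3) by (auto intro: inj_on_subset)
  have out: "dbscan_output (X \<inter> b \<alpha> s) r m (\<C> (s, r) \<alpha>)"
    "dbscan_output (X' \<inter> b \<alpha> s') r' m (\<D> (s', r') \<alpha>)"
    using \<C> \<D> \<alpha> unfolding dbscan_in_bins_def by blast+
  have nofree: "\<not> free_border_point (X' \<inter> b \<alpha> s') r' m t" for t
    using nofree \<alpha> unfolding no_free_border_points_def by blast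
  show "\<exists>!C'. C' \<in> set (\<D> (s', r') \<alpha>) \<and> \<phi> ` C \<subseteq> C'"
    using dbscan_output_image_unique[OF fin image inj short \<open>m > 0\<close> out nofree C] .
qed

section \<open>Chain maps of simplicial maps\<close>

text \<open>The sums defining chain maps and boundaries range over supports, which change from chain to chain;
  the next two lemmas let chains share one finite range of summation.\<close>

lemma simplicial_chain_map_sum:
  assumes "finite T" "{vs. c vs \<noteq> 0} \<subseteq> T" "distinct ws"
  shows "simplicial_chain_map f c ws = (\<Sum>vs | vs \<in> T \<and> map f vs = ws. c vs)"
  using assms unfolding simplicial_chain_map_def
  by (auto intro!: sum.mono_neutral_left)

lemma simplicial_boundary_sum:
  assumes "finite T" "{vs. c vs \<noteq> 0} \<subseteq> T" "[] \<notin> T" "k > 0"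
  shows "simplicial_boundary k c ws = (\<Sum>vs | vs \<in> T \<and> tl vs = ws. c vs)"
proof -
  have "(\<Sum>v | c (v # ws) \<noteq> 0. c (v # ws)) = (\<Sum>vs | c vs \<noteq> 0 \<and> tl vs = ws. c vs)"
  proof (rule sum.reindex_bij_witness[where i = hd and j = "\<lambda>v. v # ws"])
    fix vs assume "vs \<in> {vs. c vs \<noteq> 0 \<and> tl vs = ws}"
    then have "vs \<noteq> []" "c vs \<noteq> 0" "tl vs = ws"
      using assms(2,3) by auto
    then show "hd vs # ws = vs" "hd vs \<in> {v. c (v # ws) \<noteq> 0}"
      by auto
  qed auto
  also have "\<dots> = (\<Sum>vs | vs \<in> T \<and> tl vs = ws. c vs)"
    using assms(1,2) by (intro sum.mono_neutral_left) auto
  finally show ?thesis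
    using assms(4) by (simp add: simplicial_boundary_def)
qed

lemma simplicial_chains_finite: "c \<in> simplicial_chains K k \<Longrightarrow> finite {vs. c vs \<noteq> 0}"
  by (simp add: simplicial_chains_def)

lemma simplicial_chains_support:
  "c \<in> simplicial_chains K k \<Longrightarrow> c vs \<noteq> 0 \<Longrightarrow> distinct vs \<and> length vs = Suc k \<and> set vs \<in> K"
  by (auto simp: simplicial_chains_def ordered_simplices_def)

lemma simplicial_chains_permute:
  assumes "c \<in> simplicial_chains K k" "length vs = Suc k" "\<pi> permutes {..<Suc k}"
  shows "c (permute_list \<pi> vs) = of_int (sign \<pi>) * c vs"
proof (cases "vs \<in> ordered_simplices K k")
  case True
  then show ?thesis
    using assms by (simp add: simplicial_chains_def)
next
  case False
  then have "permute_list \<pi> vs \<notin> ordered_simplices K k"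
    using assms(2,3) by (simp add: ordered_simplices_def)
  moreover have "c us = 0" if "us \<notin> ordered_simplices K k" for us
    using assms(1) that unfolding simplicial_chains_def by blast
  ultimately show ?thesis
    using False by simp
qed

lemma simplicial_chains_zero: "(\<lambda>_. 0) \<in> simplicial_chains K k"
  by (simp add: simplicial_chains_def)

lemma simplicial_chains_add:
  assumes "c \<in> simplicial_chains K k" "d \<in> simplicial_chains K k"
  shows "(\<lambda>vs. c vs + d vs) \<in> simplicial_chains K k"
proof -
  have "{vs. c vs + d vs \<noteq> 0} \<subseteq> {vs. c vs \<noteq> 0} \<union> {vs. d vs \<noteq> 0}"
    by auto
  then show ?thesis
    using assms unfolding simplicial_chains_def
    by (auto simp: algebra_simps intro: finite_subset)
qed

lemma simplicial_chains_smult: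
  assumes "c \<in> simplicial_chains K k"
  shows "(\<lambda>vs. a * c vs) \<in> simplicial_chains K k"
proof -
  have "{vs. a * c vs \<noteq> 0} \<subseteq> {vs. c vs \<noteq> 0}"
    by auto
  then show ?thesis
    using assms unfolding simplicial_chains_def
    by (auto simp: algebra_simps intro: finite_subset)
qed

lemma simplicial_boundary_zero: "simplicial_boundary k (\<lambda>_. 0) = (\<lambda>_. 0)"
  by (simp add: simplicial_boundary_def fun_eq_iff)

lemma simplicial_boundary_add:
  assumes "c \<in> simplicial_chains K k" "d \<in> simplicial_chains K k"
  shows "simplicial_boundary k (\<lambda>vs. c vs + d vs)
    = (\<lambda>ws. simplicial_boundary k c ws + simplicial_boundary k d ws)"
proof (cases "k = 0")
  case False
  define T where "T = {vs. c vs \<noteq> 0} \<union> {vs. d vs \<noteq> 0}"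
  have T: "finite T" "{vs. c vs \<noteq> 0} \<subseteq> T" "{vs. d vs \<noteq> 0} \<subseteq> T" "{vs. c vs + d vs \<noteq> 0} \<subseteq> T"
    using assms[THEN simplicial_chains_finite] by (auto simp: T_def)
  have "[] \<notin> T"
    using assms[THEN simplicial_chains_support] by (force simp: T_def)
  then show ?thesis
    using False T by (simp add: fun_eq_iff simplicial_boundary_sum[of T] sum.distrib)
qed (simp add: simplicial_boundary_def fun_eq_iff)

lemma simplicial_boundary_smult:
  "simplicial_boundary k (\<lambda>vs. a * c vs) = (\<lambda>ws. a * simplicial_boundary k c ws)"
  by (cases "a = 0") (auto simp: simplicial_boundary_def fun_eq_iff sum_distrib_left)

lemma simplicial_chain_map_add:
  assumes "finite {vs. c vs \<noteq> 0}" "finite {vs. d vs \<noteq> 0}"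
  shows "simplicial_chain_map f (\<lambda>vs. c vs + d vs)
    = (\<lambda>ws. simplicial_chain_map f c ws + simplicial_chain_map f d ws)"
proof
  fix ws
  define T where "T = {vs. c vs \<noteq> 0} \<union> {vs. d vs \<noteq> 0}"
  have T: "finite T" "{vs. c vs \<noteq> 0} \<subseteq> T" "{vs. d vs \<noteq> 0} \<subseteq> T" "{vs. c vs + d vs \<noteq> 0} \<subseteq> T"
    using assms by (auto simp: T_def)
  show "simplicial_chain_map f (\<lambda>vs. c vs + d vs) ws
      = simplicial_chain_map f c ws + simplicial_chain_map f d ws"
  proof (cases "distinct ws")
    case True
    then show ?thesis
      using T by (simp add: simplicial_chain_map_sum[of T] sum.distrib)
  qed (simp add: simplicial_chain_map_def)
qed

lemma simplicial_chain_map_smult: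
  "simplicial_chain_map f (\<lambda>vs. a * c vs) = (\<lambda>ws. a * simplicial_chain_map f c ws)"
  by (cases "a = 0") (auto simp: simplicial_chain_map_def fun_eq_iff sum_distrib_left)

lemma simplicial_chain_map_zero: "simplicial_chain_map f (\<lambda>_. 0) = (\<lambda>_. 0)"
  by (simp add: simplicial_chain_map_def fun_eq_iff)

definition simplicial_map :: "('v \<Rightarrow> 'w) \<Rightarrow> 'v set set \<Rightarrow> 'w set set \<Rightarrow> bool" where
  "simplicial_map f K L \<longleftrightarrow> (\<forall>\<sigma>\<in>K. f ` \<sigma> \<in> L)"

lemma simplicial_chain_map_chain:
  assumes c: "c \<in> simplicial_chains K k" and f: "simplicial_map f K L"
  shows "simplicial_chain_map f c \<in> simplicial_chains L k"
proof -
  let ?T = "{vs. c vs \<noteq> 0}" and ?d = "simplicial_chain_map f c"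
  have source: "\<exists>vs. c vs \<noteq> 0 \<and> map f vs = ws" and distinct: "distinct ws" if "?d ws \<noteq> 0" for ws
  proof -
    show "distinct ws"
      using that by (auto simp: simplicial_chain_map_def split: if_splits)
    then have "(\<Sum>vs | c vs \<noteq> 0 \<and> map f vs = ws. c vs) \<noteq> 0"
      using that by (simp add: simplicial_chain_map_def)
    then obtain vs where "vs \<in> {vs. c vs \<noteq> 0 \<and> map f vs = ws}"
      by (rule sum.not_neutral_contains_not_neutral)
    then show "\<exists>vs. c vs \<noteq> 0 \<and> map f vs = ws"
      by blast
  qed
  have "{ws. ?d ws \<noteq> 0} \<subseteq> map f ` ?T"
    using source by blast
  then have "finite {ws. ?d ws \<noteq> 0}"
    using simplicial_chains_finite[OF c] finite_subset by blast
  moreover have "{ws. ?d ws \<noteq> 0} \<subseteq> ordered_simplices L k"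
  proof
    fix ws assume "ws \<in> {ws. ?d ws \<noteq> 0}"
    then obtain vs where vs: "c vs \<noteq> 0" "map f vs = ws" and "distinct ws"
      using source distinct by blast
    then show "ws \<in> ordered_simplices L k"
      using simplicial_chains_support[OF c vs(1)] f
      by (auto simp: ordered_simplices_def simplicial_map_def)
  qed
  moreover have "?d (permute_list \<pi> ws) = of_int (sign \<pi>) * ?d ws"
    if ws: "ws \<in> ordered_simplices L k" and \<pi>: "\<pi> permutes {..<length ws}" for ws \<pi>
  proof -
    have len: "length ws = Suc k" and "distinct ws"
      using ws by (auto simp: ordered_simplices_def)
    define \<rho> where "\<rho> = inv_into UNIV \<pi>"
    have \<pi>': "\<pi> permutes {..<Suc k}" "\<rho> permutes {..<Suc k}"
      using \<pi> len permutes_inv by (auto simp: \<rho>_def)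
    have cancel: "permute_list \<pi> (permute_list \<rho> xs) = xs"
      "permute_list \<rho> (permute_list \<pi> xs) = xs" if "length xs = Suc k" for xs :: "'z list"
      using that \<pi>' permutes_inv_o[OF \<pi>'(1)]
      by (simp_all add: permute_list_compose[symmetric] \<rho>_def)
    have nonzero: "c (permute_list \<theta> vs) \<noteq> 0" if "c vs \<noteq> 0" "\<theta> permutes {..<Suc k}" for \<theta> vs
    proof -
      have "c (permute_list \<theta> vs) = of_int (sign \<theta>) * c vs"
        using simplicial_chains_support[OF c that(1)] that(2)
        by (intro simplicial_chains_permute[OF c]) simp_all
      then show ?thesis
        using that(1) by (cases \<theta> rule: sign_cases) simp_all
    qed
    have "?d (permute_list \<pi> ws) = (\<Sum>vs | c vs \<noteq> 0 \<and> map f vs = permute_list \<pi> ws. c vs)"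
      using \<open>distinct ws\<close> \<pi> by (simp add: simplicial_chain_map_def)
    also have "\<dots> = (\<Sum>vs | c vs \<noteq> 0 \<and> map f vs = ws. c (permute_list \<pi> vs))"
    proof (rule sum.reindex_bij_witness[where i = "permute_list \<pi>" and j = "permute_list \<rho>"])
      fix vs assume "vs \<in> {vs. c vs \<noteq> 0 \<and> map f vs = permute_list \<pi> ws}"
      then have vs: "c vs \<noteq> 0" "map f vs = permute_list \<pi> ws" "length vs = Suc k"
        using simplicial_chains_support[OF c] by auto
      then show "permute_list \<pi> (permute_list \<rho> vs) = vs"
        "c (permute_list \<pi> (permute_list \<rho> vs)) = c vs"
        by (simp_all add: cancel)
      have "map f (permute_list \<rho> vs) = ws"
        using vs \<pi>' len by (simp add: permute_list_map[symmetric] cancel)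
      then show "permute_list \<rho> vs \<in> {vs. c vs \<noteq> 0 \<and> map f vs = ws}"
        using nonzero[OF vs(1) \<pi>'(2)] by simp
    next
      fix vs assume "vs \<in> {vs. c vs \<noteq> 0 \<and> map f vs = ws}"
      then have vs: "c vs \<noteq> 0" "map f vs = ws" "length vs = Suc k"
        using simplicial_chains_support[OF c] by auto
      then show "permute_list \<rho> (permute_list \<pi> vs) = vs"
        by (simp add: cancel)
      have "map f (permute_list \<pi> vs) = permute_list \<pi> ws"
        using vs \<pi>' by (simp add: permute_list_map[symmetric])
      then show "permute_list \<pi> vs \<in> {vs. c vs \<noteq> 0 \<and> map f vs = permute_list \<pi> ws}"
        using nonzero[OF vs(1) \<pi>'(1)] by simp
    qed
    also have "\<dots> = (\<Sum>vs | c vs \<noteq> 0 \<and> map f vs = ws. of_int (sign \<pi>) * c vs)"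
      using simplicial_chains_support[OF c] simplicial_chains_permute[OF c _ \<pi>'(1)]
      by (intro sum.cong) auto
    also have "\<dots> = of_int (sign \<pi>) * ?d ws"
      using \<open>distinct ws\<close> by (simp add: simplicial_chain_map_def sum_distrib_left)
    finally show ?thesis .
  qed
  ultimately show ?thesis
    by (simp add: simplicial_chains_def)
qed

text \<open>If \<open>f\<close> identifies the first vertex of a simplex with a later one, then it does so after the two are
  exchanged, and the exchange changes the sign of the coefficient. Such simplices thus cancel in
  pairs; pairing, rather than doubling the sum, covers fields of characteristic two.\<close>

lemma sum_collapsed_simplices_zero:
  assumes c: "c \<in> simplicial_chains K k" and w: "w \<in> set ws"
  shows "(\<Sum>vs | c vs \<noteq> 0 \<and> map f (tl vs) = ws \<and> f (hd vs) = w. c vs) = 0"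
proof -
  obtain i where i: "i < length ws" "ws ! i = w"
    using w by (auto simp: in_set_conv_nth)
  let ?S = "{vs. c vs \<noteq> 0 \<and> map f (tl vs) = ws \<and> f (hd vs) = w}"
  define \<tau> where "\<tau> = Transposition.transpose 0 (Suc i)"
  show ?thesis
  proof (cases "length ws = k")
    case False
    then have "?S = {}"
      using simplicial_chains_support[OF c] by fastforce
    then show ?thesis
      by (simp only: sum.empty)
  next
    case True
    have \<tau>: "\<tau> permutes {..<Suc k}"
      unfolding \<tau>_def using i(1) True by (intro permutes_swap_id) auto
    have swap: "c (permute_list \<tau> vs) = - c vs" if "length vs = Suc k" for vs
      using simplicial_chains_permute[OF c that \<tau>] by (simp add: \<tau>_def sign_swap_id)
    show ?thesis
    proof (rule sum_involution_eq_0[where h = "permute_list \<tau>"])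
      fix vs assume "vs \<in> ?S"
      then have vs: "c vs \<noteq> 0" "map f (tl vs) = ws" "f (hd vs) = w"
        and simplex: "distinct vs" "length vs = Suc k"
        using simplicial_chains_support[OF c] by auto
      show "c (permute_list \<tau> vs) + c vs = 0"
        using swap simplex by simp
      show "permute_list \<tau> (permute_list \<tau> vs) = vs"
        using \<tau> simplex by (simp add: permute_list_compose[symmetric] \<tau>_def)
      have nth: "permute_list \<tau> vs ! j = vs ! \<tau> j" if "j < Suc k" for j
        using that \<tau> simplex by (simp add: permute_list_nth)
      have "vs ! Suc i \<noteq> vs ! 0"
        using simplex i(1) True by (simp add: nth_eq_iff_index_eq)
      then show "permute_list \<tau> vs \<noteq> vs"
        using nth[of 0] by (auto simp: \<tau>_def)
      have first: "f (vs ! 0) = w"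
        using vs(3) simplex(2) by (cases vs) simp_all
      have "f (vs ! Suc i) = map f (tl vs) ! i"
        using i(1) True simplex(2) by (simp add: nth_tl)
      then have collapsed: "f (vs ! Suc i) = w"
        using vs(2) i(2) by simp
      have map_\<tau>: "map f (permute_list \<tau> vs) = map f vs"
      proof (rule nth_equalityI)
        fix j assume "j < length (map f (permute_list \<tau> vs))"
        then have j: "j < Suc k"
          using simplex by simp
        have "f (vs ! \<tau> j) = f (vs ! j)"
          using first collapsed by (simp add: \<tau>_def Transposition.transpose_def)
        then show "map f (permute_list \<tau> vs) ! j = map f vs ! j"
          using j nth simplex by simp
      qed simp
      have "permute_list \<tau> vs \<noteq> []"
        using simplex(2) by (simp flip: length_greater_0_conv)
      then have "map f (tl (permute_list \<tau> vs)) = ws" "f (hd (permute_list \<tau> vs)) = w"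
        using map_\<tau> vs(2,3) by (auto simp: map_tl[symmetric] neq_Nil_conv)
      then show "permute_list \<tau> vs \<in> ?S"
        using swap[OF simplex(2)] vs(1) by simp
    qed
  qed
qed

text \<open>Pushing a simplex forward before or after deleting its first vertex differs only for simplices whose
  first vertex is identified with a later one, and those contribute zero.\<close>

lemma simplicial_chain_map_boundary:
  assumes c: "c \<in> simplicial_chains K k"
  shows "simplicial_chain_map f (simplicial_boundary k c) = simplicial_boundary k (simplicial_chain_map f c)"
proof (cases "k = 0")
  case True
  then show ?thesis
    by (simp add: simplicial_boundary_def simplicial_chain_map_def fun_eq_iff)
next
  case False
  define T where "T = {vs. c vs \<noteq> 0}"
  have T: "finite T" "{vs. c vs \<noteq> 0} \<subseteq> T" "[] \<notin> T"
    using simplicial_chains_finite[OF c] simplicial_chains_support[OF c, of "[]"]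
    by (auto simp: T_def)
  have boundary: "simplicial_boundary k c us = (\<Sum>vs | vs \<in> T \<and> tl vs = us. c vs)" for us
    using simplicial_boundary_sum[OF T] False by simp
  show ?thesis
  proof
    fix ws
    show "simplicial_chain_map f (simplicial_boundary k c) ws
        = simplicial_boundary k (simplicial_chain_map f c) ws"
    proof (cases "distinct ws")
      case False
      then show ?thesis
        by (simp add: simplicial_chain_map_def simplicial_boundary_def)
    next
      case True
      define P where "P = {vs \<in> T. map f (tl vs) = ws}"
      have P: "finite P" "[] \<notin> P"
        using T by (auto simp: P_def)
      have "{us. simplicial_boundary k c us \<noteq> 0} \<subseteq> tl ` T"
      proof
        fix us assume "us \<in> {us. simplicial_boundary k c us \<noteq> 0}"
        then have "(\<Sum>vs | vs \<in> T \<and> tl vs = us. c vs) \<noteq> 0"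
          by (simp add: boundary)
        then obtain vs where "vs \<in> {vs. vs \<in> T \<and> tl vs = us}"
          by (rule sum.not_neutral_contains_not_neutral)
        then show "us \<in> tl ` T"
          by blast
      qed
      then have "simplicial_chain_map f (simplicial_boundary k c) ws
          = (\<Sum>us | us \<in> tl ` T \<and> map f us = ws. simplicial_boundary k c us)"
        using T(1) True by (intro simplicial_chain_map_sum) auto
      also have "\<dots> = (\<Sum>us | us \<in> tl ` T \<and> map f us = ws. \<Sum>vs | vs \<in> P \<and> tl vs = us. c vs)"
        unfolding boundary P_def by (intro sum.cong) auto
      also have "\<dots> = sum c P"
        using T(1) P(1) by (intro sum.group) (auto simp: P_def)
      finally have left: "simplicial_chain_map f (simplicial_boundary k c) ws = sum c P" .

      define W where "W = (\<lambda>vs. f (hd vs)) ` P"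
      have W: "finite W"
        using P by (simp add: W_def)
      have "simplicial_boundary k (simplicial_chain_map f c) ws
          = (\<Sum>w | simplicial_chain_map f c (w # ws) \<noteq> 0. simplicial_chain_map f c (w # ws))"
        using \<open>k \<noteq> 0\<close> by (simp add: simplicial_boundary_def)
      also have "\<dots> = (\<Sum>w\<in>W - set ws. simplicial_chain_map f c (w # ws))"
      proof (rule sum.mono_neutral_left)
        show "{w. simplicial_chain_map f c (w # ws) \<noteq> 0} \<subseteq> W - set ws"
        proof
          fix w assume w: "w \<in> {w. simplicial_chain_map f c (w # ws) \<noteq> 0}"
          then have d: "distinct (w # ws)"
            by (auto simp: simplicial_chain_map_def split: if_splits)
          have "(\<Sum>vs | vs \<in> T \<and> map f vs = w # ws. c vs) \<noteq> 0"
            using w simplicial_chain_map_sum[OF T(1,2) d, of f] by simp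
          then obtain vs where "vs \<in> {vs. vs \<in> T \<and> map f vs = w # ws}"
            by (rule sum.not_neutral_contains_not_neutral)
          then have "vs \<in> P" "f (hd vs) = w"
            by (auto simp: P_def)
          then show "w \<in> W - set ws"
            using d by (auto simp: W_def)
        qed
      qed (use W in auto)
      also have "\<dots> = (\<Sum>w\<in>W - set ws. \<Sum>vs | vs \<in> P \<and> f (hd vs) = w. c vs)"
      proof (rule sum.cong[OF refl])
        fix w assume "w \<in> W - set ws"
        then have "simplicial_chain_map f c (w # ws) = (\<Sum>vs | vs \<in> T \<and> map f vs = w # ws. c vs)"
          using True by (intro simplicial_chain_map_sum[OF T(1,2)]) simp
        also have "{vs. vs \<in> T \<and> map f vs = w # ws} = {vs. vs \<in> P \<and> f (hd vs) = w}"
        proof -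
          have "map f vs = w # ws \<longleftrightarrow> map f (tl vs) = ws \<and> f (hd vs) = w" if "vs \<in> T" for vs
            using T(3) that by (cases vs) auto
          then show ?thesis
            by (auto simp: P_def)
        qed
        finally show "simplicial_chain_map f c (w # ws) = (\<Sum>vs | vs \<in> P \<and> f (hd vs) = w. c vs)" .
      qed
      also have "\<dots> = (\<Sum>w\<in>W. \<Sum>vs | vs \<in> P \<and> f (hd vs) = w. c vs)"
      proof (rule sum.mono_neutral_left)
        show "\<forall>w\<in>W - (W - set ws). (\<Sum>vs | vs \<in> P \<and> f (hd vs) = w. c vs) = 0"
          using sum_collapsed_simplices_zero[OF c, of _ ws f] by (simp add: P_def T_def conj_assoc)
      qed (use W in auto)
      also have "\<dots> = sum c P"
        using P(1) W by (intro sum.group) (auto simp: W_def)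
      finally show ?thesis
        using left by simp
    qed
  qed
qed

lemma simplicial_chain_map_comp:
  assumes c: "c \<in> simplicial_chains K k" and h: "\<forall>v\<in>\<Union>K. g (f v) = h v"
  shows "simplicial_chain_map g (simplicial_chain_map f c) = simplicial_chain_map h c"
proof
  fix us
  define T where "T = {vs. c vs \<noteq> 0}"
  have T: "finite T" "{vs. c vs \<noteq> 0} \<subseteq> T"
    using simplicial_chains_finite[OF c] by (auto simp: T_def)
  have gf: "map g (map f vs) = map h vs" if "vs \<in> T" for vs
  proof -
    have "set vs \<in> K"
      using simplicial_chains_support[OF c, of vs] that by (simp add: T_def)
    then show ?thesis
      using bspec[OF h UnionI] by (simp only: map_map o_def map_eq_conv) simp
  qed
  show "simplicial_chain_map g (simplicial_chain_map f c) us = simplicial_chain_map h c us"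
  proof (cases "distinct us")
    case True
    define P where "P = {vs \<in> T. map h vs = us}"
    have "{ws. simplicial_chain_map f c ws \<noteq> 0} \<subseteq> map f ` T"
    proof
      fix ws assume ws: "ws \<in> {ws. simplicial_chain_map f c ws \<noteq> 0}"
      then have d: "distinct ws"
        by (auto simp: simplicial_chain_map_def split: if_splits)
      have "(\<Sum>vs | vs \<in> T \<and> map f vs = ws. c vs) \<noteq> 0"
        using ws simplicial_chain_map_sum[OF T d, of f] by simp
      then obtain vs where "vs \<in> {vs. vs \<in> T \<and> map f vs = ws}"
        by (rule sum.not_neutral_contains_not_neutral)
      then show "ws \<in> map f ` T"
        by blast
    qed
    then have "simplicial_chain_map g (simplicial_chain_map f c) us
        = (\<Sum>ws | ws \<in> map f ` T \<and> map g ws = us. simplicial_chain_map f c ws)"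
      using T(1) True by (intro simplicial_chain_map_sum) auto
    also have "\<dots> = (\<Sum>ws | ws \<in> map f ` T \<and> map g ws = us. \<Sum>vs | vs \<in> P \<and> map f vs = ws. c vs)"
    proof (rule sum.cong[OF refl])
      fix ws assume ws: "ws \<in> {ws. ws \<in> map f ` T \<and> map g ws = us}"
      then have "distinct (map g ws)"
        using True by simp
      then have "distinct ws"
        by (simp add: distinct_map)
      then have "simplicial_chain_map f c ws = (\<Sum>vs | vs \<in> T \<and> map f vs = ws. c vs)"
        by (rule simplicial_chain_map_sum[OF T])
      also have "{vs. vs \<in> T \<and> map f vs = ws} = {vs. vs \<in> P \<and> map f vs = ws}"
        using ws by (auto simp: P_def gf[symmetric] simp del: map_map)
      finally show "simplicial_chain_map f c ws = (\<Sum>vs | vs \<in> P \<and> map f vs = ws. c vs)" .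
    qed
    also have "\<dots> = sum c P"
    proof (rule sum.group)
      show "map f ` P \<subseteq> {ws. ws \<in> map f ` T \<and> map g ws = us}"
      proof (rule image_subsetI)
        fix vs assume "vs \<in> P"
        then show "map f vs \<in> {ws. ws \<in> map f ` T \<and> map g ws = us}"
          using gf[of vs] by (simp add: P_def)
      qed
    qed (use T(1) in \<open>auto simp: P_def\<close>)
    also have "\<dots> = simplicial_chain_map h c us"
      using simplicial_chain_map_sum[OF T True] by (simp add: P_def)
    finally show ?thesis .
  qed (simp add: simplicial_chain_map_def)
qed

lemma simplicial_chain_map_ident:
  assumes c: "c \<in> simplicial_chains K k" and f: "\<forall>v\<in>\<Union>K. f v = v"
  shows "simplicial_chain_map f c = c"
proof
  fix ws
  have "map f vs = vs" if "c vs \<noteq> 0" for vs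
    using simplicial_chains_support[OF c that] f by (intro map_idI) blast
  then have "{vs. c vs \<noteq> 0 \<and> map f vs = ws} = {vs. c vs \<noteq> 0 \<and> vs = ws}"
    by metis
  then have "simplicial_chain_map f c ws = (if distinct ws then \<Sum>vs | c vs \<noteq> 0 \<and> vs = ws. c vs else 0)"
    by (simp only: simplicial_chain_map_def)
  also have "\<dots> = c ws"
  proof (cases "c ws = 0")
    case True
    then have "{vs. c vs \<noteq> 0 \<and> vs = ws} = {}"
      by blast
    then show ?thesis
      using True by simp
  next
    case False
    then have "{vs. c vs \<noteq> 0 \<and> vs = ws} = {ws}" "distinct ws"
      using simplicial_chains_support[OF c] by blast+
    then show ?thesis
      by simp
  qed
  finally show "simplicial_chain_map f c ws = c ws" .
qed

section \<open>Homology as a functor\<close>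

lemma simplicial_boundaries_zero: "(\<lambda>_. 0) \<in> simplicial_boundaries K k"
  unfolding simplicial_boundaries_def
  by (rule image_eqI, rule simplicial_boundary_zero[symmetric], rule simplicial_chains_zero)

lemma simplicial_boundaries_add:
  assumes "p \<in> simplicial_boundaries K k" "q \<in> simplicial_boundaries K k"
  shows "(\<lambda>vs. p vs + q vs) \<in> simplicial_boundaries K k"
proof -
  obtain c d where c: "c \<in> simplicial_chains K (Suc k)" "p = simplicial_boundary (Suc k) c"
    and d: "d \<in> simplicial_chains K (Suc k)" "q = simplicial_boundary (Suc k) d"
    using assms by (auto simp: simplicial_boundaries_def)
  show ?thesis
    unfolding simplicial_boundaries_def c(2) d(2)
    by (rule image_eqI, rule simplicial_boundary_add[OF c(1) d(1), symmetric],
        rule simplicial_chains_add[OF c(1) d(1)])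
qed

lemma simplicial_boundaries_smult:
  assumes "p \<in> simplicial_boundaries K k"
  shows "(\<lambda>vs. a * p vs) \<in> simplicial_boundaries K k"
proof -
  obtain c where c: "c \<in> simplicial_chains K (Suc k)" "p = simplicial_boundary (Suc k) c"
    using assms by (auto simp: simplicial_boundaries_def)
  show ?thesis
    unfolding simplicial_boundaries_def c(2)
    by (rule image_eqI, rule simplicial_boundary_smult[symmetric], rule simplicial_chains_smult[OF c(1)])
qed

lemma simplicial_boundaries_diff:
  assumes "p \<in> simplicial_boundaries K k" "q \<in> simplicial_boundaries K k"
  shows "(\<lambda>vs. p vs - q vs) \<in> simplicial_boundaries K k"
  using simplicial_boundaries_add[OF assms(1) simplicial_boundaries_smult[OF assms(2), of "-1"]] by simp

lemma simplicial_cycles_zero: "(\<lambda>_. 0) \<in> simplicial_cycles K k"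
  by (simp add: simplicial_cycles_def simplicial_chains_zero simplicial_boundary_zero)

lemma simplicial_cycles_add:
  "z \<in> simplicial_cycles K k \<Longrightarrow> w \<in> simplicial_cycles K k \<Longrightarrow> (\<lambda>vs. z vs + w vs) \<in> simplicial_cycles K k"
  using simplicial_boundary_add[of z K k w] by (simp add: simplicial_cycles_def simplicial_chains_add)

lemma simplicial_cycles_smult:
  "z \<in> simplicial_cycles K k \<Longrightarrow> (\<lambda>vs. a * z vs) \<in> simplicial_cycles K k"
  by (simp add: simplicial_cycles_def simplicial_chains_smult simplicial_boundary_smult)

lemma homology_class_iff:
  "p \<in> homology_class K k z \<longleftrightarrow> (\<lambda>vs. p vs - z vs) \<in> simplicial_boundaries K k"
proof
  assume "p \<in> homology_class K k z"
  then obtain q where q: "p = (\<lambda>vs. z vs + q vs)" "q \<in> simplicial_boundaries K k"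
    by (auto simp: homology_class_def)
  then show "(\<lambda>vs. p vs - z vs) \<in> simplicial_boundaries K k"
    by simp
next
  assume "(\<lambda>vs. p vs - z vs) \<in> simplicial_boundaries K k"
  then show "p \<in> homology_class K k z"
    unfolding homology_class_def by (intro CollectI exI[of _ "\<lambda>vs. p vs - z vs"]) simp
qed

lemma homology_class_self: "z \<in> homology_class K k z"
  by (simp add: homology_class_iff simplicial_boundaries_zero)

lemma homology_class_eqI:
  assumes "(\<lambda>vs. w vs - z vs) \<in> simplicial_boundaries K k"
  shows "homology_class K k w = homology_class K k z"
proof (rule Set.set_eqI)
  fix p
  have "(\<lambda>vs. p vs - z vs) \<in> simplicial_boundaries K k"
    if "(\<lambda>vs. p vs - w vs) \<in> simplicial_boundaries K k"
    using simplicial_boundaries_add[OF that assms] by simp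
  moreover have "(\<lambda>vs. p vs - w vs) \<in> simplicial_boundaries K k"
    if "(\<lambda>vs. p vs - z vs) \<in> simplicial_boundaries K k"
    using simplicial_boundaries_diff[OF that assms] by simp
  ultimately show "p \<in> homology_class K k w \<longleftrightarrow> p \<in> homology_class K k z"
    unfolding homology_class_iff by blast
qed

lemma homology_class_zero: "homology_class K k (\<lambda>_. 0) = simplicial_boundaries K k"
  by (simp add: homology_class_def)

lemma carrier_simplicial_homology:
  "carrier (simplicial_homology K k) = homology_class K k ` simplicial_cycles K k"
  by (simp add: simplicial_homology_def)

lemma homology_class_carrier:
  "z \<in> simplicial_cycles K k \<Longrightarrow> homology_class K k z \<in> carrier (simplicial_homology K k)"
  by (simp add: carrier_simplicial_homology)

lemma zero_simplicial_homology: "\<zero>\<^bsub>simplicial_homology K k\<^esub> = homology_class K k (\<lambda>_. 0)"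
  by (simp add: simplicial_homology_def homology_class_zero)

lemma add_homology_class:
  "homology_class K k z \<oplus>\<^bsub>simplicial_homology K k\<^esub> homology_class K k w
    = homology_class K k (\<lambda>vs. z vs + w vs)"
proof -
  have "{\<lambda>vs. p vs + q vs | p q. p \<in> homology_class K k z \<and> q \<in> homology_class K k w}
      = homology_class K k (\<lambda>vs. z vs + w vs)" (is "?S = _")
  proof (rule Set.set_eqI)
    fix x
    show "x \<in> ?S \<longleftrightarrow> x \<in> homology_class K k (\<lambda>vs. z vs + w vs)"
    proof
      assume "x \<in> ?S"
      then obtain p q where x: "x = (\<lambda>vs. p vs + q vs)"
        and p: "(\<lambda>vs. p vs - z vs) \<in> simplicial_boundaries K k"
        and q: "(\<lambda>vs. q vs - w vs) \<in> simplicial_boundaries K k"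
        by (auto simp: homology_class_iff)
      show "x \<in> homology_class K k (\<lambda>vs. z vs + w vs)"
        using simplicial_boundaries_add[OF p q] by (simp add: x homology_class_iff algebra_simps)
    next
      assume "x \<in> homology_class K k (\<lambda>vs. z vs + w vs)"
      then have "(\<lambda>vs. x vs - w vs) \<in> homology_class K k z"
        by (simp add: homology_class_iff algebra_simps)
      then show "x \<in> ?S"
        using homology_class_self[of w K k]
        by (intro CollectI exI[of _ "\<lambda>vs. x vs - w vs"] exI[of _ w]) simp
    qed
  qed
  then show ?thesis
    by (simp add: simplicial_homology_def)
qed

lemma smult_homology_class:
  "a \<odot>\<^bsub>simplicial_homology K k\<^esub> homology_class K k z = homology_class K k (\<lambda>vs. a * z vs)"
proof -
  have "{\<lambda>vs. a * p vs + q vs | p q. p \<in> homology_class K k z \<and> q \<in> simplicial_boundaries K k}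
      = homology_class K k (\<lambda>vs. a * z vs)" (is "?S = _")
  proof (rule Set.set_eqI)
    fix x
    show "x \<in> ?S \<longleftrightarrow> x \<in> homology_class K k (\<lambda>vs. a * z vs)"
    proof
      assume "x \<in> ?S"
      then obtain p q where x: "x = (\<lambda>vs. a * p vs + q vs)"
        and p: "(\<lambda>vs. p vs - z vs) \<in> simplicial_boundaries K k"
        and q: "q \<in> simplicial_boundaries K k"
        by (auto simp: homology_class_iff)
      show "x \<in> homology_class K k (\<lambda>vs. a * z vs)"
        using simplicial_boundaries_add[OF simplicial_boundaries_smult[OF p, of a] q]
        by (simp add: x homology_class_iff algebra_simps)
    next
      assume "x \<in> homology_class K k (\<lambda>vs. a * z vs)"
      then obtain q where "x = (\<lambda>vs. a * z vs + q vs)" "q \<in> simplicial_boundaries K k"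
        by (auto simp: homology_class_def)
      then show "x \<in> ?S"
        using homology_class_self[of z K k] by blast
    qed
  qed
  then show ?thesis
    by (simp add: simplicial_homology_def)
qed

lemma cring_type_field: "cring (type_field :: 'f::field ring)"
proof (rule cringI)
  show "abelian_group (type_field :: 'f ring)"
  proof (rule abelian_groupI)
    fix x :: 'f
    show "\<exists>y\<in>carrier type_field. y \<oplus>\<^bsub>type_field\<^esub> x = \<zero>\<^bsub>type_field\<^esub>"
      by (intro bexI[of _ "- x"]) (simp_all add: type_field_def)
  qed (simp_all add: type_field_def algebra_simps)
  show "comm_monoid (type_field :: 'f ring)"
    by (rule comm_monoidI) (simp_all add: type_field_def)
qed (simp add: type_field_def algebra_simps)

lemma module_simplicial_homology:
  "Module.module type_field (simplicial_homology K k :: ('f::field, ('v list \<Rightarrow> 'f) set) module)"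
proof -
  let ?H = "simplicial_homology K k :: ('f, ('v list \<Rightarrow> 'f) set) module"
  note closed = homology_class_carrier simplicial_cycles_zero simplicial_cycles_add simplicial_cycles_smult
  note ops = zero_simplicial_homology add_homology_class smult_homology_class
  have cases: thesis
    if "x \<in> carrier ?H" "\<And>z. z \<in> simplicial_cycles K k \<Longrightarrow> x = homology_class K k z \<Longrightarrow> thesis"
    for x thesis
    using that by (auto simp: carrier_simplicial_homology)
  show ?thesis
  proof (rule moduleI[OF cring_type_field])
    show "abelian_group ?H"
    proof (rule abelian_groupI)
      show "\<zero>\<^bsub>?H\<^esub> \<in> carrier ?H"
        by (simp add: ops closed)
    next
      fix x y assume "x \<in> carrier ?H" "y \<in> carrier ?H"
      then show "x \<oplus>\<^bsub>?H\<^esub> y \<in> carrier ?H" "x \<oplus>\<^bsub>?H\<^esub> y = y \<oplus>\<^bsub>?H\<^esub> x"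
        by (auto elim!: cases simp: ops closed add.commute)
    next
      fix x y z assume "x \<in> carrier ?H" "y \<in> carrier ?H" "z \<in> carrier ?H"
      then show "x \<oplus>\<^bsub>?H\<^esub> y \<oplus>\<^bsub>?H\<^esub> z = x \<oplus>\<^bsub>?H\<^esub> (y \<oplus>\<^bsub>?H\<^esub> z)"
        by (auto elim!: cases simp: ops add.assoc)
    next
      fix x assume "x \<in> carrier ?H"
      then obtain z where z: "z \<in> simplicial_cycles K k" "x = homology_class K k z"
        by (rule cases)
      show "\<zero>\<^bsub>?H\<^esub> \<oplus>\<^bsub>?H\<^esub> x = x"
        by (simp add: z ops)
      show "\<exists>y\<in>carrier ?H. y \<oplus>\<^bsub>?H\<^esub> x = \<zero>\<^bsub>?H\<^esub>"
        using simplicial_cycles_smult[OF z(1), of "- 1"]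
        by (intro bexI[of _ "homology_class K k (\<lambda>vs. - 1 * z vs)"])
          (simp_all add: z ops homology_class_carrier)
    qed
  next
    fix a x assume "x \<in> carrier ?H"
    then show "a \<odot>\<^bsub>?H\<^esub> x \<in> carrier ?H"
      by (auto elim!: cases simp: ops closed)
  next
    fix a x y assume "x \<in> carrier ?H" "y \<in> carrier ?H"
    then show "a \<odot>\<^bsub>?H\<^esub> (x \<oplus>\<^bsub>?H\<^esub> y) = a \<odot>\<^bsub>?H\<^esub> x \<oplus>\<^bsub>?H\<^esub> a \<odot>\<^bsub>?H\<^esub> y"
      by (auto elim!: cases simp: ops distrib_left)
  next
    fix a b x assume "x \<in> carrier ?H"
    then obtain z where z: "x = homology_class K k z"
      by (rule cases)
    show "(a \<oplus>\<^bsub>type_field\<^esub> b) \<odot>\<^bsub>?H\<^esub> x = a \<odot>\<^bsub>?H\<^esub> x \<oplus>\<^bsub>?H\<^esub> b \<odot>\<^bsub>?H\<^esub> x"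
      by (simp add: z ops type_field_def distrib_right)
    show "(a \<otimes>\<^bsub>type_field\<^esub> b) \<odot>\<^bsub>?H\<^esub> x = a \<odot>\<^bsub>?H\<^esub> (b \<odot>\<^bsub>?H\<^esub> x)"
      by (simp add: z ops type_field_def mult.assoc)
    show "\<one>\<^bsub>type_field\<^esub> \<odot>\<^bsub>?H\<^esub> x = x"
      by (simp add: z ops type_field_def)
  qed
qed

lemma simplicial_chain_map_cycle:
  assumes z: "z \<in> simplicial_cycles K k" and f: "simplicial_map f K L"
  shows "simplicial_chain_map f z \<in> simplicial_cycles L k"
proof -
  have z: "z \<in> simplicial_chains K k" "simplicial_boundary k z = (\<lambda>_. 0)"
    using z by (simp_all add: simplicial_cycles_def)
  have "simplicial_boundary k (simplicial_chain_map f z) = (\<lambda>_. 0)"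
    using simplicial_chain_map_boundary[OF z(1), of f] by (simp add: z(2) simplicial_chain_map_zero)
  then show ?thesis
    using simplicial_chain_map_chain[OF z(1) f] by (simp add: simplicial_cycles_def)
qed

text \<open>Since chain maps commute with boundaries, all members of a class have homologous images, so the
  union over representatives is a single class.\<close>

lemma simplicial_homology_map_class:
  assumes z: "z \<in> simplicial_cycles K k" and f: "simplicial_map f K L"
  shows "simplicial_homology_map L k f (homology_class K k z)
    = homology_class L k (simplicial_chain_map f z)"
proof -
  have "homology_class L k (simplicial_chain_map f p) = homology_class L k (simplicial_chain_map f z)"
    if p: "p \<in> homology_class K k z" for p
  proof -
    obtain c where c: "c \<in> simplicial_chains K (Suc k)"
      and p: "p = (\<lambda>vs. z vs + simplicial_boundary (Suc k) c vs)"
      using p by (auto simp: homology_class_def simplicial_boundaries_def)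
    have z_fin: "finite {vs. z vs \<noteq> 0}"
      using z simplicial_chains_finite by (auto simp: simplicial_cycles_def)
    have b_fin: "finite {vs. simplicial_boundary (Suc k) c vs \<noteq> 0}"
    proof (rule finite_subset)
      show "{vs. simplicial_boundary (Suc k) c vs \<noteq> 0} \<subseteq> tl ` {vs. c vs \<noteq> 0}"
      proof
        fix us assume "us \<in> {vs. simplicial_boundary (Suc k) c vs \<noteq> 0}"
        then have "(\<Sum>v | c (v # us) \<noteq> 0. c (v # us)) \<noteq> 0"
          by (simp add: simplicial_boundary_def)
        then obtain v where "v \<in> {v. c (v # us) \<noteq> 0}"
          by (rule sum.not_neutral_contains_not_neutral)
        then show "us \<in> tl ` {vs. c vs \<noteq> 0}"
          by (intro image_eqI[of _ _ "v # us"]) simp_all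
      qed
    qed (use simplicial_chains_finite[OF c] in simp)
    have "(\<lambda>ws. simplicial_chain_map f p ws - simplicial_chain_map f z ws)
        = simplicial_boundary (Suc k) (simplicial_chain_map f c)"
      unfolding p simplicial_chain_map_add[OF z_fin b_fin] simplicial_chain_map_boundary[OF c] by simp
    also have "\<dots> \<in> simplicial_boundaries L k"
      using simplicial_chain_map_chain[OF c f] by (simp add: simplicial_boundaries_def)
    finally show ?thesis
      by (rule homology_class_eqI)
  qed
  then show ?thesis
    unfolding simplicial_homology_map_def using homology_class_self[of z K k] by blast
qed

lemma simplicial_homology_map_linear:
  assumes f: "simplicial_map f K L"
  shows "simplicial_homology_map L k f
    \<in> linear_maps (simplicial_homology K k) (simplicial_homology L k :: ('f::field, _) module)"
  unfolding linear_maps_def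
proof (intro CollectI conjI ballI allI funcsetI)
  fix x :: "('a list \<Rightarrow> 'f) set" assume "x \<in> carrier (simplicial_homology K k)"
  then obtain z where z: "z \<in> simplicial_cycles K k" "x = homology_class K k z"
    by (auto simp: carrier_simplicial_homology)
  then show "simplicial_homology_map L k f x \<in> carrier (simplicial_homology L k)"
    using simplicial_homology_map_class[OF z(1) f] simplicial_chain_map_cycle[OF z(1) f]
    by (simp add: homology_class_carrier)
  fix a
  show "simplicial_homology_map L k f (a \<odot>\<^bsub>simplicial_homology K k\<^esub> x)
      = a \<odot>\<^bsub>simplicial_homology L k\<^esub> simplicial_homology_map L k f x"
    using simplicial_homology_map_class[OF z(1) f]
      simplicial_homology_map_class[OF simplicial_cycles_smult[OF z(1)] f]
    by (simp add: z(2) smult_homology_class simplicial_chain_map_smult)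
next
  fix x y :: "('a list \<Rightarrow> 'f) set"
  assume "x \<in> carrier (simplicial_homology K k)" "y \<in> carrier (simplicial_homology K k)"
  then obtain z w where z: "z \<in> simplicial_cycles K k" "x = homology_class K k z"
    and w: "w \<in> simplicial_cycles K k" "y = homology_class K k w"
    by (auto simp: carrier_simplicial_homology)
  have "finite {vs. z vs \<noteq> 0}" "finite {vs. w vs \<noteq> 0}"
    using z(1) w(1) simplicial_chains_finite by (auto simp: simplicial_cycles_def)
  then show "simplicial_homology_map L k f (x \<oplus>\<^bsub>simplicial_homology K k\<^esub> y)
      = simplicial_homology_map L k f x \<oplus>\<^bsub>simplicial_homology L k\<^esub> simplicial_homology_map L k f y"
    using simplicial_homology_map_class[OF z(1) f] simplicial_homology_map_class[OF w(1) f]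
      simplicial_homology_map_class[OF simplicial_cycles_add[OF z(1) w(1)] f]
    by (simp add: z(2) w(2) add_homology_class simplicial_chain_map_add)
qed

lemma simplicial_homology_map_comp:
  assumes f: "simplicial_map f K L" and g: "simplicial_map g L M"
    and h: "\<forall>v\<in>\<Union>K. g (f v) = h v"
    and x: "x \<in> carrier (simplicial_homology K k)"
  shows "simplicial_homology_map M k g (simplicial_homology_map L k f x) = simplicial_homology_map M k h x"
proof -
  obtain z where z: "z \<in> simplicial_cycles K k" "x = homology_class K k z"
    using x by (auto simp: carrier_simplicial_homology)
  have "h ` \<sigma> = g ` f ` \<sigma>" if "\<sigma> \<in> K" for \<sigma>
    unfolding image_image using h that by (intro image_cong) auto
  then have "simplicial_map h K M"
    using f g by (simp add: simplicial_map_def)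
  then have "simplicial_homology_map M k h x = homology_class M k (simplicial_chain_map h z)"
    unfolding z(2) by (rule simplicial_homology_map_class[OF z(1)])
  also have "simplicial_chain_map h z = simplicial_chain_map g (simplicial_chain_map f z)"
    using z(1) h simplicial_chain_map_comp[of z K k g f h] by (simp add: simplicial_cycles_def)
  also have "homology_class M k \<dots> = simplicial_homology_map M k g (homology_class L k (simplicial_chain_map f z))"
    using simplicial_homology_map_class[OF simplicial_chain_map_cycle[OF z(1) f] g] by simp
  also have "homology_class L k (simplicial_chain_map f z) = simplicial_homology_map L k f x"
    using simplicial_homology_map_class[OF z(1) f] z(2) by simp
  finally show ?thesis ..
qed

lemma simplicial_homology_map_ident:
  assumes f: "\<forall>v\<in>\<Union>K. f v = v" and x: "x \<in> carrier (simplicial_homology K k)"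
  shows "simplicial_homology_map K k f x = x"
proof -
  obtain z where z: "z \<in> simplicial_cycles K k" "x = homology_class K k z"
    using x by (auto simp: carrier_simplicial_homology)
  have "f ` \<sigma> = \<sigma>" if "\<sigma> \<in> K" for \<sigma>
    using f that by force
  then have "simplicial_map f K K"
    by (simp add: simplicial_map_def)
  then have "simplicial_homology_map K k f x = homology_class K k (simplicial_chain_map f z)"
    unfolding z(2) by (rule simplicial_homology_map_class[OF z(1)])
  also have "simplicial_chain_map f z = z"
    using z(1) f simplicial_chain_map_ident[of z K k f] by (simp add: simplicial_cycles_def)
  finally show ?thesis
    using z(2) by simp
qed

section \<open>Interleaving of the homology of cluster covers\<close>

lemma cover_map_simplicial_map:
  assumes "maps_clusters A \<phi> \<C> u \<D> v"
  shows "simplicial_map (cover_map \<phi> \<D> v)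
    (nerve (cluster_cover A \<C> u) snd) (nerve (cluster_cover A \<D> v) snd)"
  using cover_map_nerve[OF assms] by (simp add: simplicial_map_def)

lemma Union_nerve_subset: "\<Union>(nerve I U) \<subseteq> I"
  unfolding nerve_def by blast

definition cover_homology_map ::
    "'a set \<Rightarrow> nat \<Rightarrow> ('p \<Rightarrow> 'q) \<Rightarrow> (real \<times> real \<Rightarrow> 'a \<Rightarrow> 'q set list) \<Rightarrow> real \<times> real \<Rightarrow>
     (('a \<times> 'p set) list \<Rightarrow> 'f::field) set \<Rightarrow> (('a \<times> 'q set) list \<Rightarrow> 'f) set" where
  "cover_homology_map A k \<phi> \<D> v =
     simplicial_homology_map (nerve (cluster_cover A \<D> v) snd) k (cover_map \<phi> \<D> v)"

lemma bimap_homology_bifiltration: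
  "bimap (homology_bifiltration A \<C> k) u v = cover_homology_map A k (\<lambda>x. x) \<C> v"
  by (simp add: homology_bifiltration_def cover_homology_map_def cluster_map_eq_cover_map)

lemma bispace_homology_bifiltration:
  "bispace (homology_bifiltration A \<C> k) u = simplicial_homology (nerve (cluster_cover A \<C> u) snd) k"
  by (simp add: homology_bifiltration_def)

lemma cover_homology_map_linear:
  assumes "maps_clusters A \<phi> \<C> u \<D> v"
  shows "cover_homology_map A k \<phi> \<D> v
    \<in> linear_maps (bispace (homology_bifiltration A \<C> k) u)
        (bispace (homology_bifiltration A \<D> k :: ('f::field, _) bifiltration) v)"
  unfolding cover_homology_map_def bispace_homology_bifiltration
  by (rule simplicial_homology_map_linear[OF cover_map_simplicial_map[OF assms]])

lemma cover_homology_map_comp: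
  assumes \<phi>: "maps_clusters A \<phi> \<C> u \<D> v" and \<psi>: "maps_clusters A \<psi> \<D> v \<E> w"
    and \<theta>: "maps_clusters A \<theta> \<C> u \<E> w"
    and comp: "\<forall>\<alpha>\<in>A. \<forall>C\<in>set (\<C> u \<alpha>). \<forall>x\<in>C. \<psi> (\<phi> x) = \<theta> x"
    and x: "x \<in> carrier (bispace (homology_bifiltration A \<C> k) u)"
  shows "cover_homology_map A k \<psi> \<E> w (cover_homology_map A k \<phi> \<D> v x) = cover_homology_map A k \<theta> \<E> w x"
proof -
  have "\<forall>i\<in>\<Union>(nerve (cluster_cover A \<C> u) snd).
      cover_map \<psi> \<E> w (cover_map \<phi> \<D> v i) = cover_map \<theta> \<E> w i"
  proof
    fix i assume "i \<in> \<Union>(nerve (cluster_cover A \<C> u) snd)"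
    then have "i \<in> cluster_cover A \<C> u"
      by (rule subsetD[OF Union_nerve_subset])
    then show "cover_map \<psi> \<E> w (cover_map \<phi> \<D> v i) = cover_map \<theta> \<E> w i"
      by (rule cover_map_comp[OF \<phi> \<psi> \<theta> comp])
  qed
  then show ?thesis
    using x unfolding cover_homology_map_def bispace_homology_bifiltration
    by (rule simplicial_homology_map_comp[OF cover_map_simplicial_map[OF \<phi>] cover_map_simplicial_map[OF \<psi>]])
qed

lemma cover_homology_map_refl:
  assumes "maps_clusters A (\<lambda>x. x) \<C> u \<C> u"
    and x: "x \<in> carrier (bispace (homology_bifiltration A \<C> k) u)"
  shows "cover_homology_map A k (\<lambda>x. x) \<C> u x = x"
proof -
  have "\<forall>i\<in>\<Union>(nerve (cluster_cover A \<C> u) snd). cover_map (\<lambda>x. x) \<C> u i = i"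
  proof
    fix i assume "i \<in> \<Union>(nerve (cluster_cover A \<C> u) snd)"
    then have "i \<in> cluster_cover A \<C> u"
      by (rule subsetD[OF Union_nerve_subset])
    then show "cover_map (\<lambda>x. x) \<C> u i = i"
      by (rule cover_map_refl[OF assms(1)])
  qed
  then show ?thesis
    using x unfolding cover_homology_map_def bispace_homology_bifiltration
    by (rule simplicial_homology_map_ident)
qed

lemma persistence_module_homology_bifiltration:
  assumes "\<And>u v. u \<le> v \<Longrightarrow> maps_clusters A (\<lambda>x. x) \<C> u \<C> v"
  shows "persistence_module (homology_bifiltration A \<C> k :: ('f::field, _) bifiltration)"
proof (rule persistence_module.intro)
  fix u v w :: "real \<times> real" and x
  show "Module.module type_field (bispace (homology_bifiltration A \<C> k :: ('f, _) bifiltration) u)"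
    unfolding bispace_homology_bifiltration by (rule module_simplicial_homology)
  show "bimap (homology_bifiltration A \<C> k) u v
      \<in> linear_maps (bispace (homology_bifiltration A \<C> k) u)
          (bispace (homology_bifiltration A \<C> k :: ('f, _) bifiltration) v)" if "u \<le> v"
    unfolding bimap_homology_bifiltration using assms[OF that] by (rule cover_homology_map_linear)
  assume x: "x \<in> carrier (bispace (homology_bifiltration A \<C> k :: ('f, _) bifiltration) u)"
  show "bimap (homology_bifiltration A \<C> k) u u x = x"
    unfolding bimap_homology_bifiltration using assms[OF order_refl] x by (rule cover_homology_map_refl)
  show "bimap (homology_bifiltration A \<C> k) v w (bimap (homology_bifiltration A \<C> k) u v x)
      = bimap (homology_bifiltration A \<C> k) u w x" if "u \<le> v" "v \<le> w"
    unfolding bimap_homology_bifiltration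
    by (rule cover_homology_map_comp[OF assms[OF that(1)] assms[OF that(2)]
          assms[OF order_trans[OF that]] _ x]) simp
qed

text \<open>Every identity required of an interleaving compares two composites of vertex maps which are both
  the vertex map of one and the same map of points (\<open>\<phi>\<close>, \<open>\<psi>\<close> or the identity), so it holds already on
  vertices, and homology inherits it by functoriality.\<close>

lemma interleaved_homology_bifiltration:
  fixes \<C> :: "real \<times> real \<Rightarrow> 'a \<Rightarrow> 'p set list" and \<D> :: "real \<times> real \<Rightarrow> 'a \<Rightarrow> 'q set list"
  assumes "\<xi> \<ge> 0"
    and \<C>: "\<And>u v. u \<le> v \<Longrightarrow> maps_clusters A (\<lambda>x. x) \<C> u \<C> v"
    and \<D>: "\<And>u v. u \<le> v \<Longrightarrow> maps_clusters A (\<lambda>x. x) \<D> u \<D> v"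
    and \<phi>: "\<And>u v. u + (\<xi>, \<xi>) \<le> v \<Longrightarrow> maps_clusters A \<phi> \<C> u \<D> v"
    and \<psi>: "\<And>u v. u + (\<xi>, \<xi>) \<le> v \<Longrightarrow> maps_clusters A \<psi> \<D> u \<C> v"
    and \<psi>\<phi>: "\<And>u. \<forall>\<alpha>\<in>A. \<forall>C\<in>set (\<C> u \<alpha>). \<forall>x\<in>C. \<psi> (\<phi> x) = x"
    and \<phi>\<psi>: "\<And>u. \<forall>\<alpha>\<in>A. \<forall>C\<in>set (\<D> u \<alpha>). \<forall>x\<in>C. \<phi> (\<psi> x) = x"
  shows "interleaved \<xi> (homology_bifiltration A \<C> k :: ('f::field, _) bifiltration)
    (homology_bifiltration A \<D> k)"
proof -
  let ?M = "homology_bifiltration A \<C> k :: ('f, _) bifiltration"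
  let ?N = "homology_bifiltration A \<D> k :: ('f, _) bifiltration"
  define f :: "real \<times> real \<Rightarrow> (('a \<times> 'p set) list \<Rightarrow> 'f) set \<Rightarrow> (('a \<times> 'q set) list \<Rightarrow> 'f) set"
    where "f u = cover_homology_map A k \<phi> \<D> (u + (\<xi>, \<xi>))" for u
  define g :: "real \<times> real \<Rightarrow> (('a \<times> 'q set) list \<Rightarrow> 'f) set \<Rightarrow> (('a \<times> 'p set) list \<Rightarrow> 'f) set"
    where "g u = cover_homology_map A k \<psi> \<C> (u + (\<xi>, \<xi>))" for u
  have mono: "u + (\<xi>, \<xi>) \<le> v + (\<xi>, \<xi>)" if "u \<le> v" for u v :: "real \<times> real"
    using that by (rule add_right_mono)
  have up: "u \<le> u + (2 * \<xi>, 2 * \<xi>)" for u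
    using \<open>\<xi> \<ge> 0\<close> by (cases u) simp
  have twice: "u + (\<xi>, \<xi>) + (\<xi>, \<xi>) = u + (2 * \<xi>, 2 * \<xi>)" for u
    by (cases u) simp
  have f: "persistence_morphism ?M (shifted \<xi> ?N) f"
    unfolding persistence_morphism_def shifted_def bifiltration.simps
  proof (intro conjI allI impI ballI)
    fix u show "f u \<in> linear_maps (bispace ?M u) (bispace ?N (u + (\<xi>, \<xi>)))"
      unfolding f_def by (rule cover_homology_map_linear[OF \<phi>[OF order_refl]])
  next
    fix u v :: "real \<times> real" and x assume uv: "u \<le> v" and x: "x \<in> carrier (bispace ?M u)"
    have "f v (bimap ?M u v x) = cover_homology_map A k \<phi> \<D> (v + (\<xi>, \<xi>)) x"
      unfolding f_def bimap_homology_bifiltration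
      by (rule cover_homology_map_comp[OF \<C>[OF uv] \<phi>[OF order_refl] \<phi>[OF mono[OF uv]] _ x]) simp
    also have "\<dots> = bimap ?N (u + (\<xi>, \<xi>)) (v + (\<xi>, \<xi>)) (f u x)"
      unfolding f_def bimap_homology_bifiltration
      by (rule cover_homology_map_comp[OF \<phi>[OF order_refl] \<D>[OF mono[OF uv]] \<phi>[OF mono[OF uv]] _ x, symmetric]) simp
    finally show "f v (bimap ?M u v x) = bimap ?N (u + (\<xi>, \<xi>)) (v + (\<xi>, \<xi>)) (f u x)" .
  qed
  have g: "persistence_morphism ?N (shifted \<xi> ?M) g"
    unfolding persistence_morphism_def shifted_def bifiltration.simps
  proof (intro conjI allI impI ballI)
    fix u show "g u \<in> linear_maps (bispace ?N u) (bispace ?M (u + (\<xi>, \<xi>)))"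
      unfolding g_def by (rule cover_homology_map_linear[OF \<psi>[OF order_refl]])
  next
    fix u v :: "real \<times> real" and x assume uv: "u \<le> v" and x: "x \<in> carrier (bispace ?N u)"
    have "g v (bimap ?N u v x) = cover_homology_map A k \<psi> \<C> (v + (\<xi>, \<xi>)) x"
      unfolding g_def bimap_homology_bifiltration
      by (rule cover_homology_map_comp[OF \<D>[OF uv] \<psi>[OF order_refl] \<psi>[OF mono[OF uv]] _ x]) simp
    also have "\<dots> = bimap ?M (u + (\<xi>, \<xi>)) (v + (\<xi>, \<xi>)) (g u x)"
      unfolding g_def bimap_homology_bifiltration
      by (rule cover_homology_map_comp[OF \<psi>[OF order_refl] \<C>[OF mono[OF uv]] \<psi>[OF mono[OF uv]] _ x, symmetric]) simp
    finally show "g v (bimap ?N u v x) = bimap ?M (u + (\<xi>, \<xi>)) (v + (\<xi>, \<xi>)) (g u x)" .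
  qed
  have fg: "f (u + (\<xi>, \<xi>)) (g u x) = bimap ?N u (u + (2 * \<xi>, 2 * \<xi>)) x"
    if x: "x \<in> carrier (bispace ?N u)" for u x
    unfolding f_def g_def bimap_homology_bifiltration twice
    by (rule cover_homology_map_comp[OF \<psi>[OF order_refl] \<phi>[OF eq_refl[OF twice]] \<D>[OF up] \<phi>\<psi> x])
  have gf: "g (u + (\<xi>, \<xi>)) (f u x) = bimap ?M u (u + (2 * \<xi>, 2 * \<xi>)) x"
    if x: "x \<in> carrier (bispace ?M u)" for u x
    unfolding f_def g_def bimap_homology_bifiltration twice
    by (rule cover_homology_map_comp[OF \<phi>[OF order_refl] \<psi>[OF eq_refl[OF twice]] \<C>[OF up] \<psi>\<phi> x])
  have "persistence_module ?M"
    by (rule persistence_module_homology_bifiltration) (rule \<C>)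
  moreover have "persistence_module ?N"
    by (rule persistence_module_homology_bifiltration) (rule \<D>)
  ultimately show ?thesis
    unfolding interleaved_def
    using \<open>\<xi> \<ge> 0\<close> f g fg gf by (intro conjI exI[of _ f] exI[of _ g] allI ballI) assumption+
qed

theorem corollary3:
  fixes X X\<delta> :: "(real ^ 'n) set"
    and \<delta> :: real
    and perturb :: "real ^ 'n \<Rightarrow> real ^ 'n"
    and A :: "'a set"
    and b :: "'a \<Rightarrow> real \<Rightarrow> (real ^ 'n) set"
    and MinPts k :: nat
    and \<C> \<D> :: "real \<times> real \<Rightarrow> 'a \<Rightarrow> (real ^ 'n) set list"
  assumes "finite X"
    and "\<delta> \<ge> 0"
    and "bij_betw perturb X X\<delta>"
    and "\<forall>x\<in>X. dist x (perturb x) \<le> \<delta>"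
    and "MinPts > 0"
    and "enlarging_bins A b"
    and "dbscan_in_bins X A b MinPts \<C>"
    and "dbscan_in_bins X\<delta> A b MinPts \<D>"
    and "no_free_border_points X A b MinPts"
    and "no_free_border_points X\<delta> A b MinPts"
  shows "interleaved (2 * \<delta>)
           (homology_bifiltration A \<C> k ::
              ('f::field, (('a \<times> (real ^ 'n) set) list \<Rightarrow> 'f) set) bifiltration)
           (homology_bifiltration A \<D> k)"
proof (rule interleaved_homology_bifiltration[where \<phi> = perturb and \<psi> = "inv_into X perturb"])
  let ?inv = "inv_into X perturb"
  have image: "perturb ` X = X\<delta>" and inj: "inj_on perturb X"
    using assms(3) by (auto simp: bij_betw_def)
  have finite: "finite X\<delta>"
    using assms(1) image by blast
  have inv: "?inv ` X\<delta> \<subseteq> X" "inj_on ?inv X\<delta>" "\<forall>y\<in>X\<delta>. perturb (?inv y) = y" "\<forall>x\<in>X. ?inv (perturb x) = x"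
    using image inj by (auto simp: inv_into_into f_inv_into_f inj_on_inv_into)
  have inv_dist: "dist y (?inv y) \<le> \<delta>" if y: "y \<in> X\<delta>" for y
  proof -
    have "?inv y \<in> X" "perturb (?inv y) = y"
      using inv(1,3) y by auto
    then show ?thesis
      using assms(4) by (metis dist_commute)
  qed
  show "2 * \<delta> \<ge> 0"
    using assms(2) by simp
  \<comment> \<open>The radius uses up the whole shift, the bins only half of it.\<close>
  have shift: "fst u + \<delta> \<le> fst v" "snd u + 2 * \<delta> \<le> snd v" if "u + (2 * \<delta>, 2 * \<delta>) \<le> v" for u v :: "real \<times> real"
    using that assms(2) by (auto simp: less_eq_prod_def)
  show "maps_clusters A (\<lambda>x. x) \<C> u \<C> v" if "u \<le> v" for u v
    using maps_clusters_perturbation[of X "\<lambda>x. x" X 0 "fst u" "fst v" "snd u" "snd v" MinPts A b \<C> \<C>]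
      assms(1,5,6,7,9) that by (simp add: less_eq_prod_def)
  show "maps_clusters A (\<lambda>x. x) \<D> u \<D> v" if "u \<le> v" for u v
    using maps_clusters_perturbation[of X\<delta> "\<lambda>x. x" X\<delta> 0 "fst u" "fst v" "snd u" "snd v" MinPts A b \<D> \<D>]
      finite assms(5,6,8,10) that by (simp add: less_eq_prod_def)
  show "maps_clusters A perturb \<C> u \<D> v" if "u + (2 * \<delta>, 2 * \<delta>) \<le> v" for u v
    using maps_clusters_perturbation[of X\<delta> perturb X \<delta> "fst u" "fst v" "snd u" "snd v" MinPts A b \<C> \<D>]
      finite image inj assms(2,4-8,10) shift[OF that] by simp
  show "maps_clusters A ?inv \<D> u \<C> v" if "u + (2 * \<delta>, 2 * \<delta>) \<le> v" for u v
    using maps_clusters_perturbation[of X ?inv X\<delta> \<delta> "fst u" "fst v" "snd u" "snd v" MinPts A b \<D> \<C>]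
      inv(1,2) inv_dist assms(1,2,5-9) shift[OF that] by simp
  show "\<forall>\<alpha>\<in>A. \<forall>C\<in>set (\<C> u \<alpha>). \<forall>x\<in>C. ?inv (perturb x) = x" for u
  proof (intro ballI)
    fix \<alpha> C x assume "\<alpha> \<in> A" and C: "C \<in> set (\<C> u \<alpha>)" "x \<in> C"
    then have "dbscan_output (X \<inter> b \<alpha> (fst u)) (snd u) MinPts (\<C> u \<alpha>)"
      using assms(7) by (cases u) (simp add: dbscan_in_bins_def)
    then have "x \<in> X"
      using dbscan_output_cluster_subset C by blast
    then show "?inv (perturb x) = x"
      using inv(4) by blast
  qed
  show "\<forall>\<alpha>\<in>A. \<forall>C\<in>set (\<D> u \<alpha>). \<forall>y\<in>C. perturb (?inv y) = y" for u
  proof (intro ballI)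
    fix \<alpha> C y assume "\<alpha> \<in> A" and C: "C \<in> set (\<D> u \<alpha>)" "y \<in> C"
    then have "dbscan_output (X\<delta> \<inter> b \<alpha> (fst u)) (snd u) MinPts (\<D> u \<alpha>)"
      using assms(8) by (cases u) (simp add: dbscan_in_bins_def)
    then have "y \<in> X\<delta>"
      using dbscan_output_cluster_subset C by blast
    then show "perturb (?inv y) = y"
      using inv(3) by blast
  qed
qed

end
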